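(* Let $n\ge2$. For every convex body $K\subseteq\mathbb{R}^n$ and every $v\in\mathbb{S}^{n-1}$, the isoperimetric ratio $I(K^v(t))$ of $K^v(t)$ is a quasiconcave function of $t\in(0,\infty)$.
   Context: The isoperimetric ratio of an $n$-dimensional convex body $K$ is $I(K)=\frac{\mathrm{vol}(K)}{(\mathrm{surf}(K))^{n/(n-1)}}\cdot\frac{(\mathrm{surf}(B^n))^{n/(n-1)}}{\mathrm{vol}(B^n)}$, where $\mathrm{vol}$ is $n$-dimensional volume, $\mathrm{surf}$ is surface area ($(n-1)$-dimensional measure of the boundary) and $B^n$ is the Euclidean unit ball centered at the origin. For $v\in\mathbb{S}^{n-1}$, $H$ is the hyperplane through the center of mass of $K$ with normal vector $v$; for $t>0$, $a^v_t:\mathbb{R}^n\to\mathbb{R}^n$ is the orthogonal affinity of ratio $t$ with $H$ as its fixed hyperplane (it fixes $H$ pointwise and multiplies the signed distance from $H$ by $t$ along the direction $v$); and $K^v(t)=a^v_t(K)$. A function on an interval is called quasiconcave here if it has one single (local) maximum and no (local) minima. *)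

theory Defs
  imports "HOL-Analysis.Analysis"
begin

definition convex_body :: "'a::euclidean_space set \<Rightarrow> bool" where
  "convex_body K \<longleftrightarrow> compact K \<and> convex K \<and> interior K \<noteq> {}"

(* Only the empty set gets weight 0 by fiat; points have weight 1 for d = 0, since 0 ^ 0 = 1.
   With the factor unit_ball_vol d, the d-dimensional Hausdorff measure of a d-dimensional unit
   ball is its Lebesgue measure. *)
definition hausdorff_weight :: "nat \<Rightarrow> 'a::metric_space set \<Rightarrow> ennreal" where
  "hausdorff_weight d C =
     (if C = {} then 0 else ennreal (unit_ball_vol (real d) * (diameter C / 2) ^ d))"

(* Boundedness is required because diameter is unspecified on unbounded sets. *)
definition hausdorff_premeasure :: "nat \<Rightarrow> real \<Rightarrow> 'a::metric_space set \<Rightarrow> ennreal" where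
  "hausdorff_premeasure d \<delta> A =
     (INF C \<in> {C :: nat \<Rightarrow> 'a set.
                A \<subseteq> (\<Union>i. C i) \<and> (\<forall>i. bounded (C i) \<and> diameter (C i) \<le> \<delta>)}.
        \<Sum>i. hausdorff_weight d (C i))"

definition hausdorff_measure :: "nat \<Rightarrow> 'a::metric_space set \<Rightarrow> ennreal" where
  "hausdorff_measure d A = (SUP \<delta> \<in> {0<..}. hausdorff_premeasure d \<delta> A)"

definition vol :: "'a::euclidean_space set \<Rightarrow> real" where
  "vol K = measure lebesgue K"

definition surf :: "'a::euclidean_space set \<Rightarrow> real" where
  "surf K = enn2real (hausdorff_measure (DIM('a) - 1) (frontier K))"

definition isoperimetric_ratio :: "'a::euclidean_space set \<Rightarrow> real" where
  "isoperimetric_ratio K =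
     (let p = real DIM('a) / (real DIM('a) - 1); B = cball (0::'a) 1
      in vol K / surf K powr p * (surf B powr p / vol B))"

definition center_of_mass :: "'a::euclidean_space set \<Rightarrow> 'a" where
  "center_of_mass K = (LINT x:K|lebesgue. x) /\<^sub>R vol K"

(* For a unit vector v, the orthogonal affinity of ratio t whose fixed hyperplane passes through c
   with normal vector v. *)
definition orthogonal_affinity :: "'a::real_inner \<Rightarrow> 'a \<Rightarrow> real \<Rightarrow> 'a \<Rightarrow> 'a" where
  "orthogonal_affinity c v t x = x + ((t - 1) * (v \<bullet> (x - c))) *\<^sub>R v"

lemma orthogonal_affinity_fixes_hyperplane:
  "v \<bullet> (x - c) = 0 \<Longrightarrow> orthogonal_affinity c v t x = x"
  by (simp add: orthogonal_affinity_def)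

lemma orthogonal_affinity_scales_distance:
  "norm v = 1 \<Longrightarrow> v \<bullet> (orthogonal_affinity c v t x - c) = t * (v \<bullet> (x - c))"
  by (simp add: orthogonal_affinity_def inner_add_right inner_diff_right norm_eq_1 algebra_simps)

definition stretched_body :: "'a::euclidean_space set \<Rightarrow> 'a \<Rightarrow> real \<Rightarrow> 'a set" where
  "stretched_body K v t = orthogonal_affinity (center_of_mass K) v t ` K"

(* Extrema are non-strict and local relative to the domain S. *)
definition local_max_on :: "'a::topological_space set \<Rightarrow> ('a \<Rightarrow> real) \<Rightarrow> 'a \<Rightarrow> bool" where
  "local_max_on S f x \<longleftrightarrow> x \<in> S \<and> (\<forall>\<^sub>F y in at x within S. f y \<le> f x)"

definition local_min_on :: "'a::topological_space set \<Rightarrow> ('a \<Rightarrow> real) \<Rightarrow> 'a \<Rightarrow> bool" where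
  "local_min_on S f x \<longleftrightarrow> x \<in> S \<and> (\<forall>\<^sub>F y in at x within S. f x \<le> f y)"

(* Not the usual notion (convex superlevel sets): a local maximum must exist, and it must be the
   only local extremum. *)
definition quasiconcave_on :: "real set \<Rightarrow> (real \<Rightarrow> real) \<Rightarrow> bool" where
  "quasiconcave_on S f \<longleftrightarrow> (\<exists>!x. local_max_on S f x) \<and> \<not> (\<exists>x. local_min_on S f x)"

end

theory Submission
  imports Defs
begin

text \<open>
  Stretching by the factor \<open>t\<close> multiplies the volume by \<open>t\<close>. With \<open>n\<close> the dimension, \<open>q = (n - 1) / n\<close>
  and \<open>S t\<close> the surface area of the stretched body, the isoperimetric ratio is therefore a positive
  constant times the power with exponent \<open>1 / q\<close> of the quotient \<open>t powr q / S t\<close>. If \<open>S\<close> is convex,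
  then \<open>S t - c * t powr q\<close> is strictly convex for every \<open>c > 0\<close>, because \<open>0 < q < 1\<close>. Strict convexity
  rules out local minima of the quotient and makes every local maximum a strict global one. A maximum
  exists because the quotient tends to 0 at both ends: \<open>S\<close> is bounded below by a positive constant and by
  a positive multiple of \<open>t\<close>, the areas of stretched discs in \<open>K\<close> that are orthogonal and parallel to
  \<open>v\<close>. This part is \<open>quasiconcave_power_over_convex\<close>.

  It remains to see that \<open>S\<close> is convex. If a flat piece has the unit normal vector \<open>u\<close>, its area is
  multiplied by the norm of \<open>t *\<^sub>R u + ((1 - t) * (u \<bullet> v)) *\<^sub>R v\<close>
  (\<open>area_of_stretched_flat_set\<close>). This is the norm of an affine function of \<open>t\<close>, hence convex, and
  summation over the facets settles the case of polytopes (\<open>area_stretched_polytope_convex\<close>). In general,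
  surface area is monotone under inclusion of convex bodies, because the nearest-point map is a
  contraction (\<open>area_frontier_mono\<close>). Choose a polytope \<open>P\<close> with \<open>K \<subseteq> P \<subseteq> r K\<close>, where \<open>r > 1\<close>
  and the origin is an interior point of \<open>K\<close>. These inclusions persist under stretching, so \<open>S\<close> agrees
  with a convex function up to the factor \<open>r ^ (n - 1)\<close>, for all \<open>t\<close> simultaneously, and \<open>r\<close> tends to 1.

  Surface area is a Hausdorff measure, defined by covers with small sets. What the argument uses about it
  is subadditivity, additivity on disjoint compact sets, the behaviour under Lipschitz maps, and its value
  on flat sets: up to a constant between 0 and \<open>\<infinity>\<close> it is the volume of the prism of height 1
  over the set (\<open>area_of_flat_set\<close>). The constant is the same for all hyperplanes.
\<close>

section \<open>Hausdorff measure\<close>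

lemma hausdorff_premeasure_le:
  assumes "A \<subseteq> (\<Union>i. C i)" "\<And>i. bounded (C i)" "\<And>i. diameter (C i) \<le> \<delta>"
  shows "hausdorff_premeasure d \<delta> A \<le> (\<Sum>i. hausdorff_weight d (C i))"
  unfolding hausdorff_premeasure_def by (rule INF_lower) (use assms in auto)

lemma hausdorff_premeasure_greatest:
  assumes "\<And>C. A \<subseteq> (\<Union>i. C i) \<Longrightarrow> (\<And>i. bounded (C i)) \<Longrightarrow> (\<And>i. diameter (C i) \<le> \<delta>)
    \<Longrightarrow> x \<le> (\<Sum>i. hausdorff_weight d (C i))"
  shows "x \<le> hausdorff_premeasure d \<delta> A"
  unfolding hausdorff_premeasure_def by (rule INF_greatest) (use assms in auto)

lemma hausdorff_premeasure_mono: "A \<subseteq> B \<Longrightarrow> hausdorff_premeasure d \<delta> A \<le> hausdorff_premeasure d \<delta> B"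
  unfolding hausdorff_premeasure_def by (rule INF_superset_mono) auto

lemma hausdorff_premeasure_antimono:
  "\<delta> \<le> \<epsilon> \<Longrightarrow> hausdorff_premeasure d \<epsilon> A \<le> hausdorff_premeasure d \<delta> A"
  unfolding hausdorff_premeasure_def by (rule INF_superset_mono) (auto intro: order_trans)

lemma hausdorff_weight_empty [simp]: "hausdorff_weight d {} = 0"
  by (simp add: hausdorff_weight_def)

lemma hausdorff_premeasure_empty: "\<delta> \<ge> 0 \<Longrightarrow> hausdorff_premeasure d \<delta> {} = 0"
  using hausdorff_premeasure_le[of "{}" "\<lambda>i. {}" \<delta> d] by (simp add: diameter_empty)

text \<open>Countable subadditivity of a set function defined by an infimum: choose the competitor for the
  \<open>i\<close>-th set up to an error of \<open>e / 2 ^ (i + 1)\<close>.\<close>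

lemma ennreal_le_suminf_INF:
  fixes w :: "nat \<Rightarrow> 'c \<Rightarrow> ennreal"
  assumes le: "\<And>c. (\<And>i. c i \<in> X i) \<Longrightarrow> y \<le> (\<Sum>i. w i (c i))"
  shows "y \<le> (\<Sum>i. INF c\<in>X i. w i c)"
proof (cases "(\<Sum>i. INF c\<in>X i. w i c) = top")
  case False
  then have fin: "(INF c\<in>X i. w i c) < top" for i
    using ennreal_suminf_lessD top.not_eq_extremum by blast
  show ?thesis
  proof (rule ennreal_le_epsilon)
    fix e :: real
    assume "e > 0"
    define \<epsilon> where "\<epsilon> i = ennreal (e * (1/2) ^ Suc i)" for i
    have pos: "\<epsilon> i > 0" for i
      using \<open>e > 0\<close> by (simp add: \<epsilon>_def)
    have increase: "m < m + m'" if "m < top" "m' > 0" for m m' :: ennreal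
      using that by (simp add: ennreal_add_left_cancel_less[of _ 0, simplified])
    have sum_eps: "(\<Sum>i. \<epsilon> i) = ennreal e"
      unfolding \<epsilon>_def using \<open>e > 0\<close>
      by (intro suminf_ennreal_eq) (use sums_mult[OF power_half_series, of e] in auto)
    have "\<exists>c. c \<in> X i \<and> w i c \<le> (INF c\<in>X i. w i c) + \<epsilon> i" for i
    proof -
      have "(INF c\<in>X i. w i c) < (INF c\<in>X i. w i c) + \<epsilon> i"
        by (rule increase[OF fin pos])
      then obtain c where "c \<in> X i" "w i c < (INF c\<in>X i. w i c) + \<epsilon> i"
        using iffD1[OF INF_less_iff] by blast
      then show ?thesis
        by (blast intro: less_imp_le)
    qed
    then obtain c where c: "\<And>i. c i \<in> X i" "\<And>i. w i (c i) \<le> (INF c\<in>X i. w i c) + \<epsilon> i"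
      by metis
    have "y \<le> (\<Sum>i. w i (c i))"
      by (rule le) (rule c)
    also have "\<dots> \<le> (\<Sum>i. (INF c\<in>X i. w i c) + \<epsilon> i)"
      by (intro suminf_le c) auto
    also have "\<dots> = (\<Sum>i. INF c\<in>X i. w i c) + ennreal e"
      by (simp add: suminf_add[symmetric] sum_eps)
    finally show "y \<le> (\<Sum>i. INF c\<in>X i. w i c) + ennreal e" .
  qed
qed simp

lemma ennreal_le_mult_INF:
  fixes w :: "'c \<Rightarrow> ennreal"
  assumes "r > 0" and le: "\<And>c. c \<in> X \<Longrightarrow> y \<le> ennreal r * w c"
  shows "y \<le> ennreal r * (INF c\<in>X. w c)"
proof -
  have "y / ennreal r \<le> (INF c\<in>X. w c)"
    using le \<open>r > 0\<close> by (intro INF_greatest divide_le_posI_ennreal) (auto simp: mult.commute)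
  then have "ennreal r * (y / ennreal r) \<le> ennreal r * (INF c\<in>X. w c)"
    by (rule mult_left_mono) simp
  moreover have "ennreal r * (y / ennreal r) = y"
    using \<open>r > 0\<close> ennreal_mult_divide_eq[of "ennreal r" y]
    by (simp add: ennreal_times_divide mult.commute[of "ennreal r" y])
  ultimately show ?thesis by simp
qed

lemma hausdorff_premeasure_UN:
  "hausdorff_premeasure d \<delta> (\<Union>i::nat. A i) \<le> (\<Sum>i. hausdorff_premeasure d \<delta> (A i))"
  unfolding hausdorff_premeasure_def[of d \<delta> "A _"]
proof (rule ennreal_le_suminf_INF)
  fix C :: "nat \<Rightarrow> nat \<Rightarrow> 'a set"
  assume "\<And>i. C i \<in> {C. A i \<subseteq> (\<Union>j. C j) \<and> (\<forall>j. bounded (C j) \<and> diameter (C j) \<le> \<delta>)}"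
  then have C: "\<And>i. A i \<subseteq> (\<Union>j. C i j)" "\<And>i j. bounded (C i j)" "\<And>i j. diameter (C i j) \<le> \<delta>"
    by auto
  define D where "D k = C (fst (prod_decode k)) (snd (prod_decode k))" for k
  have "(\<Union>i. A i) \<subseteq> (\<Union>k. D k)"
  proof
    fix x assume "x \<in> (\<Union>i. A i)"
    then obtain i j where "x \<in> C i j"
      using C(1) by blast
    then have "x \<in> D (prod_encode (i, j))"
      by (simp add: D_def)
    then show "x \<in> (\<Union>k. D k)" by blast
  qed
  then have "hausdorff_premeasure d \<delta> (\<Union>i. A i) \<le> (\<Sum>k. hausdorff_weight d (D k))"
    by (rule hausdorff_premeasure_le) (auto simp: D_def C)
  also have "\<dots> = (\<Sum>i. \<Sum>j. hausdorff_weight d (C i j))"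
    unfolding D_def
    using suminf_ennreal_2dimen[of "\<lambda>i. \<Sum>j. hausdorff_weight d (C i j)"
        "\<lambda>p. hausdorff_weight d (C (fst p) (snd p))"]
    by (simp add: o_def)
  finally show "hausdorff_premeasure d \<delta> (\<Union>i. A i) \<le> (\<Sum>i. \<Sum>j. hausdorff_weight d (C i j))" .
qed

lemma hausdorff_premeasure_le_measure:
  "\<delta> > 0 \<Longrightarrow> hausdorff_premeasure d \<delta> A \<le> hausdorff_measure d A"
  unfolding hausdorff_measure_def by (rule SUP_upper) auto

lemma hausdorff_measure_least:
  "(\<And>\<delta>. \<delta> > 0 \<Longrightarrow> hausdorff_premeasure d \<delta> A \<le> x) \<Longrightarrow> hausdorff_measure d A \<le> x"
  unfolding hausdorff_measure_def by (rule SUP_least) auto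

lemma hausdorff_measure_mono: "A \<subseteq> B \<Longrightarrow> hausdorff_measure d A \<le> hausdorff_measure d B"
  by (meson hausdorff_measure_least hausdorff_premeasure_le_measure hausdorff_premeasure_mono
      order_trans)

lemma hausdorff_measure_UN:
  "hausdorff_measure d (\<Union>i::nat. A i) \<le> (\<Sum>i. hausdorff_measure d (A i))"
proof (rule hausdorff_measure_least)
  fix \<delta> :: real
  assume "\<delta> > 0"
  then have "(\<Sum>i. hausdorff_premeasure d \<delta> (A i)) \<le> (\<Sum>i. hausdorff_measure d (A i))"
    by (intro suminf_le hausdorff_premeasure_le_measure) auto
  with hausdorff_premeasure_UN show "hausdorff_premeasure d \<delta> (\<Union>i. A i) \<le> (\<Sum>i. hausdorff_measure d (A i))"
    by (rule order_trans)
qed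

lemma hausdorff_measure_empty [simp]: "hausdorff_measure d {} = 0"
proof -
  have "hausdorff_measure d {} \<le> 0"
    by (rule hausdorff_measure_least) (simp add: hausdorff_premeasure_empty)
  then show ?thesis by simp
qed

text \<open>Countable subadditivity passes to finite families by padding with empty sets.\<close>

lemma finite_subadditive_of_countable:
  fixes \<mu> :: "'a set \<Rightarrow> ennreal"
  assumes sub: "\<And>A::nat \<Rightarrow> 'a set. \<mu> (\<Union>i. A i) \<le> (\<Sum>i. \<mu> (A i))" and empty: "\<mu> {} = 0"
    and "finite I"
  shows "\<mu> (\<Union>i\<in>I. A i) \<le> (\<Sum>i\<in>I. \<mu> (A i))"
proof -
  obtain h where h: "bij_betw h {..<card I} I"
    using \<open>finite I\<close> ex_bij_betw_nat_finite[of I] by (auto simp: atLeast0LessThan)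
  define B where "B n = (if n < card I then A (h n) else {})" for n
  have "(\<Union>i\<in>I. A i) = (\<Union>n. B n)"
    using h by (auto simp: B_def bij_betw_def split: if_splits) (metis imageE lessThan_iff)
  then have "\<mu> (\<Union>i\<in>I. A i) \<le> (\<Sum>n. \<mu> (B n))"
    using sub by metis
  also have "\<dots> = (\<Sum>n<card I. \<mu> (B n))"
    by (rule suminf_finite) (auto simp: B_def empty)
  also have "\<dots> = (\<Sum>i\<in>I. \<mu> (A i))"
    by (rule sum.reindex_bij_betw[OF h, THEN subst]) (auto simp: B_def)
  finally show ?thesis .
qed

text \<open>The self-similarity argument for the finiteness of the measure of a cube works at a fixed scale
  \<open>\<delta>\<close> and therefore uses the premeasures.\<close>

lemma hausdorff_premeasure_finite_UN:
  assumes "finite I" "\<delta> \<ge> 0"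
  shows "hausdorff_premeasure d \<delta> (\<Union>i\<in>I. A i) \<le> (\<Sum>i\<in>I. hausdorff_premeasure d \<delta> (A i))"
  using assms
  by (intro finite_subadditive_of_countable hausdorff_premeasure_UN hausdorff_premeasure_empty)

lemma hausdorff_measure_finite_UN:
  "finite I \<Longrightarrow> hausdorff_measure d (\<Union>i\<in>I. A i) \<le> (\<Sum>i\<in>I. hausdorff_measure d (A i))"
  by (intro finite_subadditive_of_countable hausdorff_measure_UN hausdorff_measure_empty)

text \<open>A set of diameter below the distance of A and B meets at most one of them, so a fine
  cover of the union splits into a cover of A and a cover of B.\<close>

lemma hausdorff_measure_Un_separated:
  fixes A B :: "'a::metric_space set"
  assumes sep: "\<And>x y. x \<in> A \<Longrightarrow> y \<in> B \<Longrightarrow> \<eta> \<le> dist x y" and "\<eta> > 0"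
  shows "hausdorff_measure d A + hausdorff_measure d B \<le> hausdorff_measure d (A \<union> B)"
proof -
  have split: "hausdorff_premeasure d \<delta> A + hausdorff_premeasure d \<delta> B \<le> hausdorff_premeasure d \<delta> (A \<union> B)"
    if \<delta>: "0 < \<delta>" "\<delta> < \<eta>" for \<delta>
  proof (rule hausdorff_premeasure_greatest)
    fix C :: "nat \<Rightarrow> 'a set"
    assume C: "A \<union> B \<subseteq> (\<Union>i. C i)" "\<And>i. bounded (C i)" "\<And>i. diameter (C i) \<le> \<delta>"
    define CA where "CA i = (if C i \<inter> A = {} then {} else C i)" for i
    define CB where "CB i = (if C i \<inter> B = {} then {} else C i)" for i
    have "C i \<inter> A = {} \<or> C i \<inter> B = {}" for i
    proof (rule ccontr)
      assume "\<not> ?thesis"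
      then obtain x y where xy: "x \<in> C i" "x \<in> A" "y \<in> C i" "y \<in> B" by blast
      then have "dist x y \<le> diameter (C i)"
        using C(2) diameter_bounded_bound by blast
      then show False
        using sep[of x y] xy C(3)[of i] \<delta> by linarith
    qed
    then have le: "hausdorff_weight d (CA i) + hausdorff_weight d (CB i) \<le> hausdorff_weight d (C i)" for i
      by (auto simp: CA_def CB_def)
    have coverA: "A \<subseteq> (\<Union>i. CA i)" and coverB: "B \<subseteq> (\<Union>i. CB i)"
      using C(1) by (fastforce simp: CA_def CB_def)+
    have "hausdorff_premeasure d \<delta> A \<le> (\<Sum>i. hausdorff_weight d (CA i))"
      by (rule hausdorff_premeasure_le) (use C \<delta> coverA in \<open>auto simp: CA_def diameter_empty\<close>)
    moreover have "hausdorff_premeasure d \<delta> B \<le> (\<Sum>i. hausdorff_weight d (CB i))"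
      by (rule hausdorff_premeasure_le) (use C \<delta> coverB in \<open>auto simp: CB_def diameter_empty\<close>)
    ultimately have "hausdorff_premeasure d \<delta> A + hausdorff_premeasure d \<delta> B
        \<le> (\<Sum>i. hausdorff_weight d (CA i)) + (\<Sum>i. hausdorff_weight d (CB i))"
      by (rule add_mono)
    also have "\<dots> = (\<Sum>i. hausdorff_weight d (CA i) + hausdorff_weight d (CB i))"
      by (simp add: suminf_add)
    also have "\<dots> \<le> (\<Sum>i. hausdorff_weight d (C i))"
      by (intro suminf_le le) auto
    finally show "hausdorff_premeasure d \<delta> A + hausdorff_premeasure d \<delta> B \<le> (\<Sum>i. hausdorff_weight d (C i))" .
  qed
  have *: "hausdorff_premeasure d \<delta> A + hausdorff_premeasure d \<epsilon> B \<le> hausdorff_measure d (A \<union> B)"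
    if "\<delta> > 0" "\<epsilon> > 0" for \<delta> \<epsilon>
  proof -
    define m where "m = min (\<eta> / 2) (min \<delta> \<epsilon>)"
    have m: "0 < m" "m < \<eta>" "m \<le> \<delta>" "m \<le> \<epsilon>"
      using that \<open>\<eta> > 0\<close> by (auto simp: m_def)
    have "hausdorff_premeasure d \<delta> A + hausdorff_premeasure d \<epsilon> B
        \<le> hausdorff_premeasure d m A + hausdorff_premeasure d m B"
      by (intro add_mono hausdorff_premeasure_antimono m)
    also have "\<dots> \<le> hausdorff_measure d (A \<union> B)"
      using split[OF m(1,2)] hausdorff_premeasure_le_measure[OF m(1)] by (rule order_trans)
    finally show ?thesis .
  qed
  have ne: "{0<..} \<noteq> ({} :: real set)"
    by simp
  have "hausdorff_measure d A + hausdorff_measure d B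
     = (SUP \<delta>\<in>{0<..}. SUP \<epsilon>\<in>{0<..}. hausdorff_premeasure d \<delta> A + hausdorff_premeasure d \<epsilon> B)"
    unfolding hausdorff_measure_def
    by (simp add: ennreal_SUP_add_left[OF ne, symmetric] ennreal_SUP_add_right[OF ne, symmetric])
  also have "\<dots> \<le> hausdorff_measure d (A \<union> B)"
    by (intro SUP_least *) auto
  finally show ?thesis .
qed

text \<open>Disjoint compact sets have positive distance.\<close>

lemma hausdorff_measure_disjoint_compact:
  fixes A :: "'i \<Rightarrow> 'a::heine_borel set"
  assumes "finite I" "\<And>i. i \<in> I \<Longrightarrow> compact (A i)" "disjoint_family_on A I"
  shows "(\<Sum>i\<in>I. hausdorff_measure d (A i)) \<le> hausdorff_measure d (\<Union>i\<in>I. A i)"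
  using assms
proof (induction I rule: finite_induct)
  case (insert i I)
  have cpt: "compact (A i)" "compact (\<Union>j\<in>I. A j)"
    using insert by (auto intro!: compact_UN)
  have dis: "A i \<inter> (\<Union>j\<in>I. A j) = {}"
    using insert.hyps insert.prems(2) by (force simp: disjoint_family_on_def)
  obtain \<eta> where "\<eta> > 0" "\<forall>x\<in>A i. \<forall>y\<in>(\<Union>j\<in>I. A j). \<eta> \<le> dist x y"
    using separate_compact_closed[OF cpt(1) compact_imp_closed[OF cpt(2)] dis] by blast
  then have "hausdorff_measure d (A i) + hausdorff_measure d (\<Union>j\<in>I. A j)
      \<le> hausdorff_measure d (A i \<union> (\<Union>j\<in>I. A j))"
    by (intro hausdorff_measure_Un_separated) blast+
  moreover have "(\<Sum>j\<in>I. hausdorff_measure d (A j)) \<le> hausdorff_measure d (\<Union>j\<in>I. A j)"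
    using insert by (auto simp: disjoint_family_on_def)
  ultimately show ?case
    using insert.hyps by simp (meson add_left_mono order_trans)
qed simp

text \<open>The images of the sets of a cover of \<open>A\<close>, cut down to \<open>A\<close>, cover the image of \<open>A\<close>, and their
  diameters have grown at most by the factor \<open>L\<close>.\<close>

lemma hausdorff_premeasure_lipschitz_image:
  fixes f :: "'a::metric_space \<Rightarrow> 'b::metric_space"
  assumes lip: "\<And>x y. x \<in> A \<Longrightarrow> y \<in> A \<Longrightarrow> dist (f x) (f y) \<le> L * dist x y" and "L > 0"
  shows "hausdorff_premeasure d (L * \<delta>) (f ` A) \<le> ennreal (L ^ d) * hausdorff_premeasure d \<delta> A"
proof -
  have "hausdorff_premeasure d (L * \<delta>) (f ` A) \<le> ennreal (L ^ d) * (\<Sum>i. hausdorff_weight d (C i))"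
    if C: "A \<subseteq> (\<Union>i. C i)" "\<And>i. bounded (C i)" "\<And>i. diameter (C i) \<le> \<delta>" for C :: "nat \<Rightarrow> 'a set"
  proof -
    have dist_le: "dist (f x) (f y) \<le> L * diameter (C i)" if "x \<in> C i \<inter> A" "y \<in> C i \<inter> A" for x y i
    proof -
      have "dist (f x) (f y) \<le> L * dist x y"
        using lip that by blast
      also have "\<dots> \<le> L * diameter (C i)"
        using that C(2) \<open>L > 0\<close> by (intro mult_left_mono diameter_bounded_bound) auto
      finally show ?thesis .
    qed
    have bdd: "bounded (f ` (C i \<inter> A))" for i
      unfolding bounded_two_points by (rule exI[of _ "L * diameter (C i)"]) (use dist_le in blast)
    have diam: "diameter (f ` (C i \<inter> A)) \<le> L * diameter (C i)" for i
    proof (cases "C i \<inter> A = {}")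
      case True
      then show ?thesis
        using \<open>L > 0\<close> diameter_ge_0[OF C(2)] by (simp add: diameter_empty)
    next
      case False
      then show ?thesis
        unfolding diameter_def[of "f ` (C i \<inter> A)"] using dist_le[of _ i] by (force intro!: cSUP_least)
    qed
    have "f ` A \<subseteq> (\<Union>i. f ` (C i \<inter> A))"
      using C(1) by blast
    then have "hausdorff_premeasure d (L * \<delta>) (f ` A) \<le> (\<Sum>i. hausdorff_weight d (f ` (C i \<inter> A)))"
    proof (rule hausdorff_premeasure_le[OF _ bdd])
      show "diameter (f ` (C i \<inter> A)) \<le> L * \<delta>" for i
        using diam[of i] mult_left_mono[OF C(3)[of i]] \<open>L > 0\<close> by (meson less_imp_le order_trans)
    qed
    also have "\<dots> \<le> (\<Sum>i. ennreal (L ^ d) * hausdorff_weight d (C i))"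
    proof (rule suminf_le)
      fix i
      have "unit_ball_vol (real d) * (diameter (f ` (C i \<inter> A)) / 2) ^ d
          \<le> unit_ball_vol (real d) * (L * diameter (C i) / 2) ^ d"
        using diam[of i] bdd[of i] by (intro mult_left_mono power_mono divide_right_mono)
          (auto simp: diameter_ge_0 unit_ball_vol_nonneg)
      also have "\<dots> = L ^ d * (unit_ball_vol (real d) * (diameter (C i) / 2) ^ d)"
        by (simp add: power_mult_distrib power_divide)
      finally show "hausdorff_weight d (f ` (C i \<inter> A)) \<le> ennreal (L ^ d) * hausdorff_weight d (C i)"
        using \<open>L > 0\<close> C(2)[of i]
        by (auto simp: hausdorff_weight_def ennreal_mult[symmetric] diameter_ge_0 unit_ball_vol_nonneg
            intro!: ennreal_leI)
    qed auto
    finally show ?thesis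
      by simp
  qed
  then show ?thesis
    unfolding hausdorff_premeasure_def[of d \<delta> A] using \<open>L > 0\<close>
    by (intro ennreal_le_mult_INF) auto
qed

lemma hausdorff_measure_lipschitz_image:
  fixes f :: "'a::metric_space \<Rightarrow> 'b::metric_space"
  assumes "\<And>x y. x \<in> A \<Longrightarrow> y \<in> A \<Longrightarrow> dist (f x) (f y) \<le> L * dist x y" and "L > 0"
  shows "hausdorff_measure d (f ` A) \<le> ennreal (L ^ d) * hausdorff_measure d A"
proof (rule hausdorff_measure_least)
  fix \<delta> :: real
  assume "\<delta> > 0"
  have "hausdorff_premeasure d \<delta> (f ` A) \<le> ennreal (L ^ d) * hausdorff_premeasure d (\<delta> / L) A"
    using hausdorff_premeasure_lipschitz_image[OF assms, where d = d and \<delta> = "\<delta> / L"] \<open>L > 0\<close> by simp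
  also have "\<dots> \<le> ennreal (L ^ d) * hausdorff_measure d A"
    using \<open>\<delta> > 0\<close> \<open>L > 0\<close> by (intro mult_left_mono hausdorff_premeasure_le_measure) auto
  finally show "hausdorff_premeasure d \<delta> (f ` A) \<le> ennreal (L ^ d) * hausdorff_measure d A" .
qed

lemma hausdorff_measure_contraction_image:
  assumes "\<And>x y. x \<in> A \<Longrightarrow> y \<in> A \<Longrightarrow> dist (f x) (f y) \<le> dist x y"
  shows "hausdorff_measure d (f ` A) \<le> hausdorff_measure d A"
  using hausdorff_measure_lipschitz_image[of A f, where L=1] assms by simp

lemma hausdorff_measure_isometry_image:
  assumes iso: "\<And>x y. x \<in> A \<Longrightarrow> y \<in> A \<Longrightarrow> dist (f x) (f y) = dist x y"
  shows "hausdorff_measure d (f ` A) = hausdorff_measure d A"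
proof (rule antisym)
  have inj: "inj_on f A"
    by (rule inj_onI) (metis iso dist_eq_0_iff)
  have "hausdorff_measure d (inv_into A f ` (f ` A)) \<le> hausdorff_measure d (f ` A)"
    by (rule hausdorff_measure_contraction_image) (use iso inj in \<open>auto\<close>)
  then show "hausdorff_measure d A \<le> hausdorff_measure d (f ` A)"
    by (simp add: inj)
qed (use iso in \<open>auto intro!: hausdorff_measure_contraction_image\<close>)

lemma hausdorff_measure_affinity_le:
  fixes A :: "'a::real_normed_vector set"
  assumes "r > 0"
  shows "hausdorff_measure d ((\<lambda>x. a + r *\<^sub>R x) ` A) \<le> ennreal (r ^ d) * hausdorff_measure d A"
  by (rule hausdorff_measure_lipschitz_image)
     (use assms in \<open>auto simp: dist_norm scaleR_diff_right[symmetric]\<close>)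

lemma hausdorff_measure_translation:
  fixes A :: "'a::real_normed_vector set"
  shows "hausdorff_measure d ((+) a ` A) = hausdorff_measure d A"
  by (rule hausdorff_measure_isometry_image) simp

section \<open>Set functions proportional to Lebesgue measure\<close>

lemma cube_as_affine_image:
  fixes c :: "'a::euclidean_space"
  assumes "r > 0"
  shows "(\<lambda>x. c + r *\<^sub>R x) ` cbox 0 One = cbox c (c + r *\<^sub>R One)"
  using image_affinity_cbox[of r c 0 "One::'a"] assms by (simp add: add.commute)

lemma emeasure_lebesgue_cube:
  fixes c :: "'a::euclidean_space"
  assumes "r > 0"
  shows "emeasure lebesgue (cbox c (c + r *\<^sub>R One)) = ennreal (r ^ DIM('a))"
  using assms by (simp add: emeasure_lborel_cbox_eq inner_add_left)

text \<open>The scaling law determines \<open>\<nu>\<close> on all cubes up to the factor \<open>\<nu> (cbox 0 One)\<close>. A Borel set can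
  be covered by nonoverlapping dyadic cubes with little waste, so subadditivity gives the upper bound;
  the lower bound is the upper bound for the complement of the set in a large cube. Because only
  subadditivity enters, the result applies to \<open>\<nu>\<close> obtained from Hausdorff outer measure as well as
  to \<open>\<nu>\<close> obtained by transporting Lebesgue measure along a linear map.\<close>

lemma proportional_to_lebesgue:
  fixes \<nu> :: "'a::euclidean_space set \<Rightarrow> ennreal"
  assumes mono: "\<And>A B. A \<in> sets borel \<Longrightarrow> B \<in> sets borel \<Longrightarrow> A \<subseteq> B \<Longrightarrow> \<nu> A \<le> \<nu> B"
    and sub: "\<And>A::nat \<Rightarrow> 'a set. range A \<subseteq> sets borel \<Longrightarrow> \<nu> (\<Union>i. A i) \<le> (\<Sum>i. \<nu> (A i))"
    and empty: "\<nu> {} = 0"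
    and scale: "\<And>a r c s. r > 0 \<Longrightarrow> s > 0 \<Longrightarrow>
       \<nu> ((\<lambda>x. a + r *\<^sub>R x) ` cbox c (c + s *\<^sub>R One)) \<le> ennreal (r ^ DIM('a)) * \<nu> (cbox c (c + s *\<^sub>R One))"
    and fin: "\<nu> (cbox 0 One) < top"
    and S: "S \<in> sets borel" "bounded S"
  shows "\<nu> S = \<nu> (cbox 0 One) * emeasure lebesgue S"
proof -
  define \<kappa> where "\<kappa> = \<nu> (cbox 0 One)"
  let ?L = "emeasure lebesgue :: 'a set \<Rightarrow> ennreal"
  have cube: "\<nu> (cbox c (c + r *\<^sub>R One)) = \<kappa> * ennreal (r ^ DIM('a))" if "r > 0" for c r
  proof (rule antisym)
    show "\<nu> (cbox c (c + r *\<^sub>R One)) \<le> \<kappa> * ennreal (r ^ DIM('a))"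
      using scale[of r 1 c 0] that cube_as_affine_image[OF that, of c]
      by (simp add: \<kappa>_def mult.commute)
    have "(\<lambda>x. (- (1 / r) *\<^sub>R c) + (1 / r) *\<^sub>R x) ` cbox c (c + r *\<^sub>R One) = cbox 0 (One::'a)"
      unfolding cube_as_affine_image[OF that, symmetric] image_image
      using that by (simp add: algebra_simps)
    then have "\<kappa> \<le> ennreal ((1 / r) ^ DIM('a)) * \<nu> (cbox c (c + r *\<^sub>R One))"
      using scale[of "1/r" r "- (1 / r) *\<^sub>R c" c] that by (simp add: \<kappa>_def)
    then have "\<kappa> * ennreal (r ^ DIM('a))
        \<le> ennreal ((1 / r) ^ DIM('a)) * \<nu> (cbox c (c + r *\<^sub>R One)) * ennreal (r ^ DIM('a))"
      by (rule mult_right_mono) simp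
    also have "\<dots> = ennreal ((1 / r) ^ DIM('a) * r ^ DIM('a)) * \<nu> (cbox c (c + r *\<^sub>R One))"
      using that by (simp add: ennreal_mult mult_ac)
    also have "(1 / r) ^ DIM('a) * r ^ DIM('a) = 1"
      using that by (simp add: power_mult_distrib[symmetric])
    finally show "\<kappa> * ennreal (r ^ DIM('a)) \<le> \<nu> (cbox c (c + r *\<^sub>R One))"
      using that by simp
  qed
  obtain R where R: "R > 0" "S \<subseteq> cbox (- (R *\<^sub>R One)) (R *\<^sub>R One)"
  proof -
    obtain a where "S \<subseteq> cbox (-a) a"
      using bounded_subset_cbox_symmetric[OF S(2)] by blast
    moreover define R where "R = norm a + 1"
    have "\<bar>a \<bullet> i\<bar> \<le> R" if "i \<in> Basis" for i
      using Basis_le_norm[OF that, of a] by (simp add: R_def)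
    then have "cbox (-a) a \<subseteq> cbox (- (R *\<^sub>R One)) (R *\<^sub>R One)"
      by (auto simp: subset_box)
    moreover have "R > 0"
      using norm_ge_zero[of a] unfolding R_def by linarith
    ultimately show ?thesis
      using that[of R] by blast
  qed
  define Q where "Q = cbox (- (R *\<^sub>R One)) (R *\<^sub>R One :: 'a)"
  have Q_eq: "Q = cbox (- (R *\<^sub>R One)) (- (R *\<^sub>R One) + (2 * R) *\<^sub>R One)"
    by (simp add: Q_def scaleR_2 algebra_simps flip: scaleR_scaleR)
  have Q: "Q \<in> sets borel" "?L Q < top"
    using emeasure_lborel_cbox_finite[of "- (R *\<^sub>R One)" "R *\<^sub>R One :: 'a"] by (auto simp: Q_def)
  have upper: "\<nu> T \<le> \<kappa> * ?L T" if T: "T \<in> sets borel" "T \<subseteq> Q" for T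
  proof -
    have T_fin: "?L T < top"
      using emeasure_mono[of T Q lebesgue] T Q by auto
    then have T_meas: "T \<in> lmeasurable"
      using T(1) by (simp add: fmeasurable_def)
    have eps: "\<nu> T \<le> \<kappa> * (?L T + ennreal e)" if "e > 0" for e
    proof -
      obtain \<D> where D: "countable \<D>"
        "\<And>K. K \<in> \<D> \<Longrightarrow> K \<subseteq> Q \<and> K \<noteq> {} \<and> (\<exists>c d. K = cbox c d)"
        "pairwise (\<lambda>A B. interior A \<inter> interior B = {}) \<D>"
        "\<And>u v. cbox u v \<in> \<D> \<Longrightarrow> \<exists>n. \<forall>i \<in> Basis. v \<bullet> i - u \<bullet> i = ((R *\<^sub>R One) \<bullet> i - (- (R *\<^sub>R One)) \<bullet> i)/2^n"
        "T \<subseteq> \<Union>\<D>" "\<Union>\<D> \<in> lmeasurable" "measure lebesgue (\<Union>\<D>) \<le> measure lebesgue T + e"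
        using measurable_outer_intervals_bounded[OF T_meas T(2)[unfolded Q_def] \<open>e > 0\<close>]
        unfolding Q_def by metis
      have is_cube: "\<exists>c r. r > 0 \<and> K = cbox c (c + r *\<^sub>R One)" if KD: "K \<in> \<D>" for K
      proof -
        obtain c d where K: "K = cbox c d"
          using D(2)[OF KD] by blast
        obtain n where n: "\<forall>i \<in> Basis. d \<bullet> i - c \<bullet> i = 2 * R / 2 ^ n"
          using D(4)[of c d] KD K by auto
        have "d = c + (2 * R / 2 ^ n) *\<^sub>R One"
        proof (rule euclidean_eqI)
          fix i :: 'a assume "i \<in> Basis"
          then show "d \<bullet> i = (c + (2 * R / 2 ^ n) *\<^sub>R One) \<bullet> i"
            using n[rule_format, of i] by (simp add: inner_add_left)
        qed
        then show ?thesis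
          using K \<open>R > 0\<close> by (intro exI[of _ c] exI[of _ "2 * R / 2 ^ n"]) simp
      qed
      \<comment> \<open>an enumeration without repetitions, padded by empty sets if \<open>\<D>\<close> is finite\<close>
      define A where "A i = (if i \<in> to_nat_on \<D> ` \<D> then from_nat_into \<D> i else {})" for i
      have A_cases: "A i = {} \<or> A i \<in> \<D>" for i
        using D(1) by (auto simp: A_def)
      have UA: "(\<Union>i. A i) = \<Union>\<D>"
      proof
        show "\<Union>\<D> \<subseteq> (\<Union>i. A i)"
        proof
          fix x assume "x \<in> \<Union>\<D>"
          then obtain K where "K \<in> \<D>" "x \<in> K" by blast
          then have "x \<in> A (to_nat_on \<D> K)"
            using D(1) by (simp add: A_def)
          then show "x \<in> (\<Union>i. A i)" by blast
        qed
      qed (use A_cases in blast)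
      have A_borel: "range A \<subseteq> sets borel"
        using A_cases is_cube by (metis borel_closed closed_cbox image_subsetI sets.empty_sets)
      have A_val: "\<nu> (A i) = \<kappa> * ?L (interior (A i))" for i
      proof (cases "A i = {}")
        case False
        then obtain c r where cr: "r > 0" "A i = cbox c (c + r *\<^sub>R One)"
          using A_cases is_cube by metis
        have "?L (interior (A i)) = ?L (A i)"
          by (simp add: cr interior_cbox emeasure_lborel_box_eq emeasure_lborel_cbox_eq)
        then show ?thesis
          using cube[OF cr(1), of c] emeasure_lebesgue_cube[OF cr(1), of c] cr(2) by simp
      qed (simp add: empty)
      have "disjoint_family (\<lambda>i. interior (A i))"
        unfolding disjoint_family_on_def
      proof (intro ballI impI)
        fix i j :: nat assume "i \<noteq> j"
        show "interior (A i) \<inter> interior (A j) = {}"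
        proof (cases "A i = {} \<or> A j = {}")
          case False
          then obtain K L where KL: "K \<in> \<D>" "i = to_nat_on \<D> K" "L \<in> \<D>" "j = to_nat_on \<D> L"
            by (auto simp: A_def split: if_splits)
          then have "A i = K" "A j = L" "K \<noteq> L"
            using D(1) \<open>i \<noteq> j\<close> by (auto simp: A_def)
          then show ?thesis
            using D(3) KL by (auto simp: pairwise_def)
        qed auto
      qed
      then have sum_int: "(\<Sum>i. ?L (interior (A i))) = ?L (\<Union>i. interior (A i))"
        by (intro suminf_emeasure) auto
      have "\<nu> T \<le> \<nu> (\<Union>i. A i)"
        using D(5) UA T by (intro mono sets.countable_UN[OF A_borel]) auto
      also have "\<dots> \<le> (\<Sum>i. \<nu> (A i))"
        by (rule sub[OF A_borel])
      also have "\<dots> = \<kappa> * ?L (\<Union>i. interior (A i))"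
        unfolding sum_int[symmetric] by (simp add: A_val)
      also have "?L (\<Union>i. interior (A i)) \<le> ?L (\<Union>\<D>)"
        using UA interior_subset by (intro emeasure_mono) (use D(6) in \<open>auto, fastforce\<close>)
      also have "?L (\<Union>\<D>) \<le> ?L T + ennreal e"
        using D(7) \<open>e > 0\<close> T_meas D(6)
        by (simp add: emeasure_eq_measure2 ennreal_plus[symmetric] ennreal_leI del: ennreal_plus)
      finally show ?thesis
        by (simp add: mult_left_mono)
    qed
    \<comment> \<open>an excess of \<open>e / (k + 1)\<close> in the cover costs at most \<open>e\<close>, also if \<open>k = 0\<close>\<close>
    obtain k where k: "\<kappa> = ennreal k" "k \<ge> 0"
      using fin by (metis \<kappa>_def ennreal_cases less_irrefl)
    show ?thesis
    proof (rule ennreal_le_epsilon)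
      fix e :: real assume "e > 0"
      have "\<nu> T \<le> \<kappa> * (?L T + ennreal (e / (k + 1)))"
        using \<open>e > 0\<close> k by (intro eps) simp
      also have "\<dots> = \<kappa> * ?L T + ennreal (k * (e / (k + 1)))"
        using k \<open>e > 0\<close> by (simp only: distrib_left) (simp add: ennreal_mult[symmetric])
      also have "k * (e / (k + 1)) \<le> e"
        using k \<open>e > 0\<close> by (simp add: field_simps)
      finally show "\<nu> T \<le> \<kappa> * ?L T + ennreal e"
        by (simp add: ennreal_leI add_left_mono)
    qed
  qed
  have SQ: "S \<subseteq> Q" "Q - S \<in> sets borel"
    using R S Q by (auto simp: Q_def)
  have "?L (Q - S) < top"
    using emeasure_mono[of "Q - S" Q lebesgue] Q by auto
  then have Xfin: "\<kappa> * ?L (Q - S) \<noteq> top"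
    using fin by (auto simp: \<kappa>_def ennreal_mult_eq_top_iff)
  have "\<kappa> * ?L S + \<kappa> * ?L (Q - S) = \<kappa> * ?L Q"
    using SQ S Q plus_emeasure[of S lebesgue "Q - S"] by (simp add: distrib_left[symmetric] Un_absorb1)
  also have "\<dots> = \<nu> Q"
  proof -
    have "\<nu> Q = \<kappa> * ennreal ((2 * R) ^ DIM('a))"
      unfolding Q_eq using \<open>R > 0\<close> by (intro cube) simp
    moreover have "?L Q = ennreal ((2 * R) ^ DIM('a))"
      unfolding Q_eq using \<open>R > 0\<close> by (intro emeasure_lebesgue_cube) simp
    ultimately show ?thesis by simp
  qed
  also have "\<dots> \<le> \<nu> S + \<nu> (Q - S)"
  proof -
    define A where "A i = (if i = 0 then S else if i = Suc 0 then Q - S else {})" for i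
    have "Q = (\<Union>i. A i)"
      using SQ by (auto simp: A_def split: if_splits intro: exI[of _ 0] exI[of _ "Suc 0"])
    moreover have "range A \<subseteq> sets borel"
      using S SQ by (auto simp: A_def)
    ultimately have "\<nu> Q \<le> (\<Sum>i. \<nu> (A i))"
      using sub by metis
    also have "\<dots> = (\<Sum>i<2. \<nu> (A i))"
      by (rule suminf_finite) (auto simp: A_def empty)
    finally show ?thesis
      by (simp add: A_def numeral_2_eq_2)
  qed
  also have "\<dots> \<le> \<nu> S + \<kappa> * ?L (Q - S)"
    using SQ by (intro add_left_mono upper) auto
  finally have "\<kappa> * ?L S \<le> \<nu> S"
    using Xfin by (simp add: add.commute[of _ "\<kappa> * ?L (Q - S)"] ennreal_add_left_cancel_le)
  with upper[OF S(1) SQ(1)] show ?thesis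
    by (simp add: \<kappa>_def antisym)
qed

section \<open>Volume under linear maps\<close>

text \<open>The factor \<open>c\<close> is the absolute value of the determinant. For the maps
  considered below it follows from multiplicativity and symmetry.\<close>

definition scales_volume :: "('a::euclidean_space \<Rightarrow> 'a) \<Rightarrow> real \<Rightarrow> bool" where
  "scales_volume f c \<longleftrightarrow> c > 0 \<and>
     (\<forall>S. S \<in> sets borel \<longrightarrow> bounded S \<longrightarrow> emeasure lebesgue (f ` S) = ennreal c * emeasure lebesgue S)"

lemma scales_volumeD:
  "scales_volume f c \<Longrightarrow> S \<in> sets borel \<Longrightarrow> bounded S
    \<Longrightarrow> emeasure lebesgue (f ` S) = ennreal c * emeasure lebesgue S"
  by (simp add: scales_volume_def)

lemma scales_volume_measure:
  assumes "scales_volume f c" "S \<in> sets borel" "bounded S"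
  shows "measure lebesgue (f ` S) = c * measure lebesgue S"
  using assms by (simp add: scales_volume_def measure_def enn2real_mult)

lemma linear_inj_inverse:
  fixes f :: "'a::euclidean_space \<Rightarrow> 'a"
  assumes "linear f" "inj f"
  obtains g where "linear g" "inj g" "\<And>x. g (f x) = x" "\<And>x. f (g x) = x"
proof -
  obtain g where g: "linear g" "g \<circ> f = id"
    using linear_injective_left_inverse[OF assms] by blast
  have gf: "g (f x) = x" for x
    using g(2) by (metis comp_apply id_apply)
  have "surj f"
    using linear_inj_imp_surj[OF assms] .
  then have fg: "f (g x) = x" for x
    by (metis gf surjD)
  show ?thesis
    by (rule that[OF g(1) _ gf fg]) (metis fg injI)
qed

lemma borel_linear_image:
  fixes f :: "'a::euclidean_space \<Rightarrow> 'a"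
  assumes "linear f" "inj f" "S \<in> sets borel"
  shows "f ` S \<in> sets borel"
proof -
  obtain g where g: "linear g" "\<And>x. g (f x) = x" "\<And>x. f (g x) = x"
    using linear_inj_inverse[OF assms(1,2)] by metis
  have "g \<in> borel_measurable borel"
    using g(1) by (intro borel_measurable_continuous_onI linear_continuous_on) (simp add: linear_conv_bounded_linear)
  then have "g -` S \<inter> space borel \<in> sets borel"
    using assms(3) by (rule measurable_sets)
  moreover have "f ` S = g -` S \<inter> space borel"
    using g by (auto simp: image_iff) metis
  ultimately show ?thesis by simp
qed

lemma bounded_linear_image_of_linear:
  fixes f :: "'a::euclidean_space \<Rightarrow> 'b::euclidean_space"
  shows "linear f \<Longrightarrow> bounded S \<Longrightarrow> bounded (f ` S)"
  by (simp add: bounded_linear_image linear_conv_bounded_linear)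

lemma linear_scales_volume:
  fixes f :: "'a::euclidean_space \<Rightarrow> 'a"
  assumes f: "linear f" "inj f"
  shows "\<exists>c. scales_volume f c"
proof -
  define \<nu> where "\<nu> S = emeasure lebesgue (f ` S)" for S
  define Q where "Q = cbox 0 (One :: 'a)"
  have fb: "f ` S \<in> sets borel" if "S \<in> sets borel" for S
    using borel_linear_image[OF f that] .
  have bounded_fin: "emeasure lebesgue (f ` S) < top" if "S \<in> sets borel" "bounded S" for S
  proof -
    have "f ` S \<in> lmeasurable"
      using fb[OF that(1)] bounded_linear_image_of_linear[OF f(1) that(2)]
      by (intro bounded_set_imp_lmeasurable) auto
    then show ?thesis
      using fmeasurableD2 top.not_eq_extremum by blast
  qed
  have prop_eq: "\<nu> S = \<nu> Q * emeasure lebesgue S" if S: "S \<in> sets borel" "bounded S" for S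
    unfolding Q_def
  proof (rule proportional_to_lebesgue[OF _ _ _ _ _ S])
    show "\<nu> A \<le> \<nu> B" if "A \<in> sets borel" "B \<in> sets borel" "A \<subseteq> B" for A B
      unfolding \<nu>_def using that fb by (intro emeasure_mono) auto
    show "\<nu> (\<Union>i. A i) \<le> (\<Sum>i. \<nu> (A i))" if "range A \<subseteq> sets borel" for A :: "nat \<Rightarrow> 'a set"
      unfolding \<nu>_def image_UN using that fb by (intro emeasure_subadditive_countably) auto
    show "\<nu> {} = 0"
      by (simp add: \<nu>_def)
    show "\<nu> (cbox 0 One) < top"
      unfolding \<nu>_def by (rule bounded_fin) auto
    fix a c :: 'a and r s :: real
    assume "r > 0"
    have "f ` ((\<lambda>x. a + r *\<^sub>R x) ` cbox c (c + s *\<^sub>R One)) = (\<lambda>x. r *\<^sub>R x + f a) ` (f ` cbox c (c + s *\<^sub>R One))"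
      by (simp add: image_image linear_add[OF f(1)] linear_scale[OF f(1)] add.commute)
    then show "\<nu> ((\<lambda>x. a + r *\<^sub>R x) ` cbox c (c + s *\<^sub>R One)) \<le> ennreal (r ^ DIM('a)) * \<nu> (cbox c (c + s *\<^sub>R One))"
      unfolding \<nu>_def using emeasure_lebesgue_affine[of r "f a"] \<open>r > 0\<close> by simp
  qed
  obtain g where g: "linear g" "inj g" "\<And>x. f (g x) = x"
    using linear_inj_inverse[OF f] by metis
  have "g ` Q \<in> sets borel" "bounded (g ` Q)"
    using borel_linear_image[OF g(1,2)] bounded_linear_image_of_linear[OF g(1)] by (auto simp: Q_def)
  then have "\<nu> (g ` Q) = \<nu> Q * emeasure lebesgue (g ` Q)"
    by (rule prop_eq)
  moreover have "\<nu> (g ` Q) = 1"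
    by (simp add: \<nu>_def image_image g Q_def emeasure_lborel_cbox_eq)
  ultimately have "\<nu> Q \<noteq> 0" by auto
  moreover have "\<nu> Q < top"
    unfolding \<nu>_def by (rule bounded_fin) (auto simp: Q_def)
  ultimately obtain c where "\<nu> Q = ennreal c" "c > 0"
    by (metis ennreal_cases ennreal_0 less_irrefl not_less order_le_less ennreal_neg)
  then show ?thesis
    using prop_eq by (auto simp: scales_volume_def \<nu>_def)
qed

lemma scales_volume_unit_cube:
  assumes "scales_volume f c"
  shows "emeasure lebesgue (f ` cbox 0 One) = ennreal c"
  using scales_volumeD[OF assms, of "cbox 0 One"] by (simp add: emeasure_lborel_cbox_eq)

lemma scales_volume_unique:
  assumes "scales_volume f c" "scales_volume f e"
  shows "c = e"
proof -
  have "ennreal c = ennreal e"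
    using scales_volume_unit_cube[OF assms(1)] scales_volume_unit_cube[OF assms(2)] by simp
  then show ?thesis
    using assms by (simp add: scales_volume_def)
qed

lemma scales_volume_compose:
  assumes "linear f" "inj f" "scales_volume f c" "scales_volume g e"
  shows "scales_volume (\<lambda>x. g (f x)) (c * e)"
  unfolding scales_volume_def
proof (intro conjI allI impI)
  show "c * e > 0"
    using assms by (simp add: scales_volume_def)
  fix S :: "'a set"
  assume S: "S \<in> sets borel" "bounded S"
  have "emeasure lebesgue (g ` (f ` S)) = ennreal e * (ennreal c * emeasure lebesgue S)"
    using scales_volumeD[OF assms(4) borel_linear_image[OF assms(1,2) S(1)]
        bounded_linear_image_of_linear[OF assms(1) S(2)]] scales_volumeD[OF assms(3) S] by simp
  then show "emeasure lebesgue ((\<lambda>x. g (f x)) ` S) = ennreal (c * e) * emeasure lebesgue S"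
    using assms by (simp add: image_image scales_volume_def ennreal_mult mult_ac)
qed

text \<open>An isometry preserves the unit ball, so the volume factor is 1.\<close>

lemma scales_volume_isometry:
  fixes f :: "'a::euclidean_space \<Rightarrow> 'a"
  assumes "orthogonal_transformation f"
  shows "scales_volume f 1"
proof -
  have f: "linear f" "inj f"
    using assms by (simp_all add: orthogonal_transformation_linear orthogonal_transformation_inj)
  obtain c where c: "scales_volume f c"
    using linear_scales_volume[OF f] by blast
  have "f ` cball 0 1 = cball 0 1"
    using image_orthogonal_transformation_cball[OF assms, of 0 1] linear_0[OF f(1)] by simp
  then have "c * measure lebesgue (cball 0 1 :: 'a set) = measure lebesgue (cball 0 1 :: 'a set)"
    using scales_volume_measure[OF c, of "cball 0 1"] by simp
  then have "c = 1"
    using content_cball_pos[of 1 "0::'a"] by simp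
  with c show ?thesis by simp
qed

lemma orthogonal_affinity_0_eq: "orthogonal_affinity 0 u t x = x + ((t - 1) * (u \<bullet> x)) *\<^sub>R u"
  by (simp add: orthogonal_affinity_def)

lemma linear_orthogonal_affinity_0: "linear (orthogonal_affinity 0 u t)"
  by (intro linearI) (simp_all add: orthogonal_affinity_0_eq inner_add_right algebra_simps)

lemma orthogonal_affinity_0_inverse:
  assumes "norm u = 1" "t \<noteq> 0"
  shows "orthogonal_affinity 0 u (1/t) (orthogonal_affinity 0 u t x) = x"
proof -
  have "u \<bullet> u = 1"
    using assms by (simp add: norm_eq_1)
  then have "u \<bullet> (x + ((t - 1) * (u \<bullet> x)) *\<^sub>R u) = t * (u \<bullet> x)"
    by (simp add: inner_add_right left_diff_distrib)
  then have "(1 / t - 1) * (u \<bullet> (x + ((t - 1) * (u \<bullet> x)) *\<^sub>R u)) = - ((t - 1) * (u \<bullet> x))"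
    using assms by (simp add: field_simps)
  then show ?thesis
    by (simp only: orthogonal_affinity_0_eq) simp
qed

lemma inj_orthogonal_affinity_0:
  "norm u = 1 \<Longrightarrow> t \<noteq> 0 \<Longrightarrow> inj (orthogonal_affinity 0 u t)"
  by (metis injI orthogonal_affinity_0_inverse)

text \<open>The reflection that exchanges \<open>u\<close> and \<open>b\<close> has the normal vector \<open>u - b\<close>.\<close>

lemma orthogonal_transformation_between_units:
  fixes u b :: "'a::euclidean_space"
  assumes "norm u = 1" "norm b = 1"
  obtains R where "orthogonal_transformation R" "R u = b"
proof (cases "u = b")
  case True
  then show ?thesis
    using that[of "\<lambda>x. x"] by simp
next
  case False
  define w where "w = u - b"
  define R where "R x = x - (2 * (x \<bullet> w) / (w \<bullet> w)) *\<^sub>R w" for x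
  have uu: "u \<bullet> u = 1" "b \<bullet> b = 1"
    using assms by (simp_all add: norm_eq_1)
  have w0: "w \<bullet> w \<noteq> 0"
    using False by (simp add: w_def)
  have "linear R"
    by (intro linearI) (simp_all add: R_def inner_add_left algebra_simps add_divide_distrib)
  moreover have "R x \<bullet> R y = x \<bullet> y" for x y
  proof -
    have "R x \<bullet> R y = x \<bullet> y - 4 * (x \<bullet> w) * (y \<bullet> w) / (w \<bullet> w)
        + (2 * (x \<bullet> w) / (w \<bullet> w)) * (2 * (y \<bullet> w) / (w \<bullet> w)) * (w \<bullet> w)"
      by (simp add: R_def inner_diff_left inner_diff_right inner_commute algebra_simps)
    also have "\<dots> = x \<bullet> y"
      using w0 by (simp add: field_simps)
    finally show ?thesis .
  qed
  ultimately have "orthogonal_transformation R"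
    by (simp add: orthogonal_transformation_def)
  moreover have "R u = b"
  proof -
    have "w \<bullet> w = 2 * (u \<bullet> w)"
      using uu by (simp add: w_def inner_diff_left inner_diff_right inner_commute)
    then have "2 * (u \<bullet> w) / (w \<bullet> w) = 1"
      using w0 by (metis divide_self)
    then have "R u = u - w"
      unfolding R_def by (simp only: scaleR_one)
    then show ?thesis
      by (simp add: w_def)
  qed
  ultimately show ?thesis by (rule that)
qed

text \<open>A rotation that takes \<open>u\<close> to a basis vector \<open>b\<close> conjugates the stretching along \<open>u\<close> into the
  stretching along \<open>b\<close>, and the latter maps the unit cube to a box with one side of length \<open>t\<close>.\<close>

lemma scales_volume_orthogonal_affinity:
  fixes u :: "'a::euclidean_space"
  assumes u: "norm u = 1" and "t > 0"
  shows "scales_volume (orthogonal_affinity 0 u t) t"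
proof -
  obtain b :: 'a where b: "b \<in> Basis"
    using nonempty_Basis by blast
  obtain R where R: "orthogonal_transformation R" "R u = b"
    using orthogonal_transformation_between_units[OF u norm_Basis[OF b]] .
  have nb: "norm b = 1" and bb: "b \<bullet> b = 1"
    using b by simp_all
  have lin: "linear (orthogonal_affinity 0 u t)" "inj (orthogonal_affinity 0 u t)"
     "linear (orthogonal_affinity 0 b t)" "inj (orthogonal_affinity 0 b t)" "linear R" "inj R"
    using u nb \<open>t > 0\<close> R linear_orthogonal_affinity_0 inj_orthogonal_affinity_0 orthogonal_transformation_linear
      orthogonal_transformation_inj by force+
  obtain c e where ce: "scales_volume (orthogonal_affinity 0 u t) c" "scales_volume (orthogonal_affinity 0 b t) e"
    using linear_scales_volume lin by metis
  have "orthogonal_affinity 0 b t (R x) = R (orthogonal_affinity 0 u t x)" for x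
  proof -
    have "b \<bullet> R x = u \<bullet> x"
      using R by (metis orthogonal_transformation_def)
    then show ?thesis
      using R by (simp add: orthogonal_affinity_0_eq linear_add[OF lin(5)] linear_scale[OF lin(5)])
  qed
  then have "c * 1 = 1 * e"
    using scales_volume_compose[OF lin(1,2) ce(1) scales_volume_isometry[OF R(1)]]
      scales_volume_compose[OF lin(5,6) scales_volume_isometry[OF R(1)] ce(2)]
    by (auto intro: scales_volume_unique)
  moreover have "e = t"
  proof -
    have comp: "orthogonal_affinity 0 b t x \<bullet> i = (if i = b then t * (x \<bullet> i) else x \<bullet> i)"
      if "i \<in> Basis" for x i
      using that b by (simp add: orthogonal_affinity_0_eq inner_add_left inner_Basis inner_commute algebra_simps)
    have "orthogonal_affinity 0 b t ` cbox 0 One = cbox 0 (orthogonal_affinity 0 b t One)"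
    proof
      show "orthogonal_affinity 0 b t ` cbox 0 One \<subseteq> cbox 0 (orthogonal_affinity 0 b t One)"
        using \<open>t > 0\<close> by (auto simp: mem_box comp)
      show "cbox 0 (orthogonal_affinity 0 b t One) \<subseteq> orthogonal_affinity 0 b t ` cbox 0 One"
      proof
        fix y assume y: "y \<in> cbox 0 (orthogonal_affinity 0 b t One)"
        define x where "x = orthogonal_affinity 0 b (1/t) y"
        have comp': "x \<bullet> i = (if i = b then y \<bullet> i / t else y \<bullet> i)" if "i \<in> Basis" for i
          using that b unfolding x_def
          by (simp add: orthogonal_affinity_0_eq inner_add_left inner_Basis inner_commute algebra_simps)
        have "y \<bullet> i \<le> (if i = b then t else 1) \<and> 0 \<le> y \<bullet> i" if "i \<in> Basis" for i
          using y that by (auto simp: mem_box comp split: if_splits)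
        then have "x \<in> cbox 0 One"
          using \<open>t > 0\<close> by (fastforce simp: mem_box comp' field_simps)
        moreover have "y = orthogonal_affinity 0 b t x"
          unfolding x_def using orthogonal_affinity_0_inverse[OF nb, of "1/t" y] \<open>t > 0\<close> by simp
        ultimately show "y \<in> orthogonal_affinity 0 b t ` cbox 0 One" by blast
      qed
    qed
    moreover have "emeasure lebesgue (cbox 0 (orthogonal_affinity 0 b t One)) = ennreal t"
    proof -
      have "(\<Prod>i\<in>Basis. orthogonal_affinity 0 b t One \<bullet> i) = (\<Prod>i\<in>Basis. if i = b then t else 1)"
        using b by (intro prod.cong) (auto simp: comp)
      also have "\<dots> = t"
        using b by (simp add: prod.delta)
      finally show ?thesis
        using \<open>t > 0\<close> by (auto simp: emeasure_lborel_cbox_eq comp)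
    qed
    ultimately have "ennreal e = ennreal t"
      using scales_volume_unit_cube[OF ce(2)] by simp
    then show ?thesis
      using ce \<open>t > 0\<close> by (simp add: scales_volume_def)
  qed
  ultimately show ?thesis
    using ce by simp
qed

text \<open>The reflection in the hyperplane orthogonal to \<open>u\<close> conjugates the shear by \<open>z\<close> into the shear by
  \<open>- z\<close>, which is its inverse. Hence the volume factor \<open>c\<close> satisfies \<open>c * c = 1\<close>.\<close>

lemma scales_volume_shear:
  fixes u z :: "'a::euclidean_space"
  assumes u: "norm u = 1" and z: "z \<bullet> u = 0"
  shows "scales_volume (\<lambda>x. x + (x \<bullet> u) *\<^sub>R z) 1"
proof -
  define sh where "sh y x = x + (x \<bullet> u) *\<^sub>R y" for x y
  define \<rho> where "\<rho> = orthogonal_affinity 0 u (-1)"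
  have uu: "u \<bullet> u = 1"
    using u by (simp add: norm_eq_1)
  have lin: "linear (sh y)" for y
    by (intro linearI) (simp_all add: sh_def inner_add_left algebra_simps)
  have inv: "sh (- y) (sh y x) = x" if "y \<bullet> u = 0" for x y
    using that by (simp add: sh_def inner_add_left)
  have inj: "inj (sh y)" if "y \<bullet> u = 0" for y
    using inv[OF that] by (metis injI)
  have "linear \<rho>" "inj \<rho>"
    using u by (simp_all add: \<rho>_def linear_orthogonal_affinity_0 inj_orthogonal_affinity_0)
  moreover have "\<rho> x \<bullet> \<rho> y = x \<bullet> y" for x y
    using uu by (simp add: \<rho>_def orthogonal_affinity_0_eq inner_add_left inner_add_right inner_diff_left
        inner_diff_right inner_commute algebra_simps)
  ultimately have \<rho>: "orthogonal_transformation \<rho>" "linear \<rho>" "inj \<rho>"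
    by (simp_all add: orthogonal_transformation_def)
  obtain c where c: "scales_volume (sh z) c"
    using linear_scales_volume[OF lin inj[OF z]] by blast
  have "\<rho> (sh z (\<rho> x)) = sh (- z) x" for x
  proof -
    have "u \<bullet> \<rho> x = - (u \<bullet> x)"
      using uu by (simp add: \<rho>_def orthogonal_affinity_0_eq inner_diff_right)
    moreover have "\<rho> (\<rho> x) = x"
      using orthogonal_affinity_0_inverse[OF u, of "-1" x] by (simp add: \<rho>_def)
    moreover have "\<rho> z = z"
      using z by (simp add: \<rho>_def orthogonal_affinity_0_eq inner_commute)
    ultimately show ?thesis
      by (simp add: sh_def linear_add[OF \<rho>(2)] linear_diff[OF \<rho>(2)] linear_scale[OF \<rho>(2)] inner_commute[of _ u])
  qed
  moreover have "scales_volume (\<lambda>x. \<rho> (sh z (\<rho> x))) (1 * c * 1)"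
    using scales_volume_compose[of "\<lambda>x. sh z (\<rho> x)" "1 * c" \<rho> 1]
      scales_volume_compose[OF \<rho>(2,3) scales_volume_isometry[OF \<rho>(1)] c]
      scales_volume_isometry[OF \<rho>(1)] linear_compose[OF \<rho>(2) lin, of z]
      inj_compose[OF inj[OF z] \<rho>(3)]
    by (simp add: o_def)
  ultimately have "scales_volume (sh (- z)) c"
    by simp
  then have "scales_volume (\<lambda>x. sh (-z) (sh z x)) (c * c)"
    by (rule scales_volume_compose[OF lin inj[OF z] c])
  then have "scales_volume (\<lambda>x::'a. x) (c * c)"
    by (simp add: inv[OF z])
  then have "c * c = 1"
    using scales_volume_isometry[OF orthogonal_transformation_id] scales_volume_unique by blast
  then have "c = 1"
    using c by (simp add: scales_volume_def) (metis abs_of_pos power2_eq_1_iff power2_eq_square less_asym neg_0_less_iff_less zero_less_one)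
  with c show ?thesis
    by (simp add: sh_def[abs_def])
qed

text \<open>The map fixes the hyperplane orthogonal to \<open>u\<close> and takes \<open>u\<close> to \<open>w\<close>: a stretching along \<open>u\<close>
  followed by a shear.\<close>

lemma scales_volume_oblique:
  fixes u w :: "'a::euclidean_space"
  assumes u: "norm u = 1" and w: "w \<bullet> u > 0"
  shows "scales_volume (\<lambda>x. x + (x \<bullet> u) *\<^sub>R (w - u)) (w \<bullet> u)"
proof -
  define \<beta> where "\<beta> = w \<bullet> u"
  define z where "z = (1 / \<beta>) *\<^sub>R w - u"
  have uu: "u \<bullet> u = 1"
    using u by (simp add: norm_eq_1)
  have "\<beta> > 0"
    using w by (simp add: \<beta>_def)
  have "z \<bullet> u = 0"
    using \<open>\<beta> > 0\<close> uu by (simp add: z_def inner_diff_left \<beta>_def)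
  have "scales_volume (\<lambda>x. orthogonal_affinity 0 u \<beta> x + (orthogonal_affinity 0 u \<beta> x \<bullet> u) *\<^sub>R z) (\<beta> * 1)"
    using \<open>\<beta> > 0\<close>
    by (intro scales_volume_compose[of "orthogonal_affinity 0 u \<beta>" \<beta> "\<lambda>x. x + (x \<bullet> u) *\<^sub>R z"]
        scales_volume_orthogonal_affinity scales_volume_shear linear_orthogonal_affinity_0
        inj_orthogonal_affinity_0 u \<open>z \<bullet> u = 0\<close>) auto
  moreover have "orthogonal_affinity 0 u \<beta> x + (orthogonal_affinity 0 u \<beta> x \<bullet> u) *\<^sub>R z
      = x + (x \<bullet> u) *\<^sub>R (w - u)" for x
  proof -
    have "orthogonal_affinity 0 u \<beta> x \<bullet> u = \<beta> * (x \<bullet> u)"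
      using uu by (simp add: orthogonal_affinity_0_eq inner_add_left inner_commute algebra_simps)
    then show ?thesis
      using \<open>\<beta> > 0\<close> by (simp add: orthogonal_affinity_0_eq z_def inner_commute algebra_simps)
  qed
  ultimately show ?thesis
    by (simp add: \<beta>_def)
qed

section \<open>Area of flat sets\<close>

abbreviation area :: "'a::euclidean_space set \<Rightarrow> ennreal" where
  "area A \<equiv> hausdorff_measure (DIM('a) - 1) A"

text \<open>This is the upper integral over \<open>s\<close> of the area of the slice of \<open>E\<close> at height \<open>s\<close>. The slice
  areas need not depend measurably on \<open>s\<close>, and \<open>nn_integral\<close> is a lower integral on nonmeasurable
  functions, so countable subadditivity requires the infimum over measurable majorants.\<close>

definition sliced_area :: "'a::euclidean_space \<Rightarrow> 'a set \<Rightarrow> ennreal" where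
  "sliced_area u E =
     (INF g \<in> {g \<in> borel_measurable borel. \<forall>s. area {x \<in> E. x \<bullet> u = s} \<le> g s}. \<integral>\<^sup>+ s. g s \<partial>lborel)"

lemma sliced_area_le:
  assumes "g \<in> borel_measurable borel" "\<And>s. area {x \<in> E. x \<bullet> u = s} \<le> g s"
  shows "sliced_area u E \<le> (\<integral>\<^sup>+ s. g s \<partial>lborel)"
  unfolding sliced_area_def by (rule INF_lower) (use assms in auto)

lemma sliced_area_greatest:
  assumes "\<And>g. g \<in> borel_measurable borel \<Longrightarrow> (\<And>s. area {x \<in> E. x \<bullet> u = s} \<le> g s)
    \<Longrightarrow> c \<le> (\<integral>\<^sup>+ s. g s \<partial>lborel)"
  shows "c \<le> sliced_area u E"
  unfolding sliced_area_def by (rule INF_greatest) (use assms in auto)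

lemma sliced_area_mono: "A \<subseteq> B \<Longrightarrow> sliced_area u A \<le> sliced_area u B"
  unfolding sliced_area_def
  by (rule INF_superset_mono)
     (auto intro: order_trans[OF hausdorff_measure_mono, rotated] simp: subset_iff)

lemma sliced_area_empty: "sliced_area u {} = 0"
  using sliced_area_le[of "\<lambda>_. 0" "{}" u] by simp

lemma sliced_area_UN: "sliced_area u (\<Union>i::nat. E i) \<le> (\<Sum>i. sliced_area u (E i))"
  unfolding sliced_area_def[of u "E _"]
proof (rule ennreal_le_suminf_INF)
  fix g :: "nat \<Rightarrow> real \<Rightarrow> ennreal"
  assume "\<And>i. g i \<in> {g \<in> borel_measurable borel. \<forall>s. area {x \<in> E i. x \<bullet> u = s} \<le> g s}"
  then have g: "\<And>i. g i \<in> borel_measurable borel" "\<And>i s. area {x \<in> E i. x \<bullet> u = s} \<le> g i s"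
    by auto
  have "sliced_area u (\<Union>i. E i) \<le> (\<integral>\<^sup>+ s. (\<Sum>i. g i s) \<partial>lborel)"
  proof (rule sliced_area_le)
    show "(\<lambda>s. \<Sum>i. g i s) \<in> borel_measurable borel"
      using g(1) by measurable
    fix s
    have slice: "{x \<in> (\<Union>i. E i). x \<bullet> u = s} = (\<Union>i. {x \<in> E i. x \<bullet> u = s})"
      by blast
    have "area {x \<in> (\<Union>i. E i). x \<bullet> u = s} \<le> (\<Sum>i. area {x \<in> E i. x \<bullet> u = s})"
      unfolding slice by (rule hausdorff_measure_UN)
    also have "\<dots> \<le> (\<Sum>i. g i s)"
      by (intro suminf_le g) auto
    finally show "area {x \<in> (\<Union>i. E i). x \<bullet> u = s} \<le> (\<Sum>i. g i s)" .
  qed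
  also have "\<dots> = (\<Sum>i. \<integral>\<^sup>+ s. g i s \<partial>lborel)"
    using g(1) by (intro nn_integral_suminf) simp
  finally show "sliced_area u (\<Union>i. E i) \<le> (\<Sum>i. \<integral>\<^sup>+ s. g i s \<partial>lborel)" .
qed

text \<open>The slices contribute the factor \<open>r ^ (n - 1)\<close> and the substitution in the heights contributes
  another factor \<open>r\<close>.\<close>

lemma sliced_area_affinity_le:
  fixes E :: "'a::euclidean_space set"
  assumes "r > 0"
  shows "sliced_area u ((\<lambda>x. a + r *\<^sub>R x) ` E) \<le> ennreal (r ^ DIM('a)) * sliced_area u E"
proof -
  let ?d = "DIM('a) - 1"
  have d: "r ^ DIM('a) = r ^ ?d * r"
    by (metis DIM_positive Suc_diff_1 power_Suc2)
  have "sliced_area u ((\<lambda>x. a + r *\<^sub>R x) ` E) \<le> ennreal (r ^ DIM('a)) * (\<integral>\<^sup>+ s. g s \<partial>lborel)"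
    if g[measurable]: "g \<in> borel_measurable borel" and ge: "\<And>s. area {x \<in> E. x \<bullet> u = s} \<le> g s" for g
  proof -
    have "sliced_area u ((\<lambda>x. a + r *\<^sub>R x) ` E)
        \<le> (\<integral>\<^sup>+ s. ennreal (r ^ ?d) * g (- (a \<bullet> u) / r + (1 / r) * s) \<partial>lborel)"
    proof (rule sliced_area_le)
      fix s
      define s' where "s' = - (a \<bullet> u) / r + (1 / r) * s"
      have slice: "{x \<in> (\<lambda>x. a + r *\<^sub>R x) ` E. x \<bullet> u = s} = (\<lambda>x. a + r *\<^sub>R x) ` {x \<in> E. x \<bullet> u = s'}"
        using \<open>r > 0\<close> by (auto simp: s'_def inner_add_left field_simps)
      have "area {x \<in> (\<lambda>x. a + r *\<^sub>R x) ` E. x \<bullet> u = s} \<le> ennreal (r ^ ?d) * area {x \<in> E. x \<bullet> u = s'}"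
        unfolding slice by (rule hausdorff_measure_affinity_le[OF \<open>r > 0\<close>])
      also have "\<dots> \<le> ennreal (r ^ ?d) * g s'"
        by (intro mult_left_mono ge) simp
      finally show "area {x \<in> (\<lambda>x. a + r *\<^sub>R x) ` E. x \<bullet> u = s}
          \<le> ennreal (r ^ ?d) * g (- (a \<bullet> u) / r + (1 / r) * s)"
        by (simp add: s'_def)
    qed measurable
    also have "\<dots> = ennreal (r ^ ?d) * (\<integral>\<^sup>+ s. g (- (a \<bullet> u) / r + (1 / r) * s) \<partial>lborel)"
      by (rule nn_integral_cmult) measurable
    also have "(\<integral>\<^sup>+ s. g (- (a \<bullet> u) / r + (1 / r) * s) \<partial>lborel) = ennreal r * (\<integral>\<^sup>+ s. g s \<partial>lborel)"
      using \<open>r > 0\<close> nn_integral_real_affine[OF g, of "1/r" "- (a \<bullet> u) / r"]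
      by (simp add: mult.assoc[symmetric] ennreal_mult[symmetric])
    finally show ?thesis
      using \<open>r > 0\<close> by (simp add: d ennreal_mult mult.assoc)
  qed
  then show ?thesis
    unfolding sliced_area_def[of u E] using \<open>r > 0\<close>
    by (intro ennreal_le_mult_INF) auto
qed

definition prism :: "'a::euclidean_space \<Rightarrow> 'a set \<Rightarrow> 'a set" where
  "prism w F = {x + s *\<^sub>R w | x s. x \<in> F \<and> s \<in> {0..1}}"

lemma prism_eq_image: "prism w F = (\<lambda>(x, s). x + s *\<^sub>R w) ` (F \<times> {0..1})"
  unfolding prism_def by fastforce

lemma compact_prism: "compact F \<Longrightarrow> compact (prism w F)"
  unfolding prism_eq_image
  by (intro compact_continuous_image compact_Times) (auto simp: case_prod_unfold intro!: continuous_intros)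

text \<open>All slices of a prism over \<open>F\<close> are translates of \<open>F\<close>, for heights in an interval of length 1.\<close>

lemma sliced_area_prism:
  assumes "norm u = 1" and F: "F \<subseteq> {x. x \<bullet> u = \<alpha>}"
  shows "sliced_area u (prism u F) = area F"
proof -
  have uu: "u \<bullet> u = 1"
    using assms by (simp add: norm_eq_1)
  have slice: "{x \<in> prism u F. x \<bullet> u = s} = (if s \<in> {\<alpha>..\<alpha>+1} then (+) ((s - \<alpha>) *\<^sub>R u) ` F else {})" for s
  proof -
    have "x \<in> {x \<in> prism u F. x \<bullet> u = s} \<longleftrightarrow> s \<in> {\<alpha>..\<alpha>+1} \<and> x \<in> (+) ((s - \<alpha>) *\<^sub>R u) ` F" for x
    proof
      assume "x \<in> {x \<in> prism u F. x \<bullet> u = s}"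
      then obtain y r where y: "y \<in> F" "0 \<le> r" "r \<le> 1" "x = y + r *\<^sub>R u" "x \<bullet> u = s"
        by (auto simp: prism_def)
      then have "r = s - \<alpha>"
        using F uu by (auto simp: inner_add_left)
      then show "s \<in> {\<alpha>..\<alpha>+1} \<and> x \<in> (+) ((s - \<alpha>) *\<^sub>R u) ` F"
        using y by (auto simp: add.commute)
    next
      assume "s \<in> {\<alpha>..\<alpha>+1} \<and> x \<in> (+) ((s - \<alpha>) *\<^sub>R u) ` F"
      then obtain y where y: "y \<in> F" "x = y + (s - \<alpha>) *\<^sub>R u" "s - \<alpha> \<in> {0..1}"
        by (auto simp: add.commute)
      moreover have "x \<bullet> u = s"
        using y F uu by (auto simp: inner_add_left)
      ultimately show "x \<in> {x \<in> prism u F. x \<bullet> u = s}"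
        unfolding prism_def by blast
    qed
    then show ?thesis by auto
  qed
  have area_slice: "area {x \<in> prism u F. x \<bullet> u = s} = area F * indicator {\<alpha>..\<alpha>+1} s" for s
    by (simp add: slice hausdorff_measure_translation)
  have int: "(\<integral>\<^sup>+ s. area F * indicator {\<alpha>..\<alpha>+1} s \<partial>lborel) = area F"
    by (subst nn_integral_cmult_indicator) auto
  show ?thesis
  proof (rule antisym)
    show "sliced_area u (prism u F) \<le> area F"
      using sliced_area_le[of "\<lambda>s. area F * indicator {\<alpha>..\<alpha>+1} s" "prism u F" u] area_slice int by simp
    show "area F \<le> sliced_area u (prism u F)"
    proof (rule sliced_area_greatest)
      fix g :: "real \<Rightarrow> ennreal"
      assume "\<And>s. area {x \<in> prism u F. x \<bullet> u = s} \<le> g s"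
      then have "(\<integral>\<^sup>+ s. area F * indicator {\<alpha>..\<alpha>+1} s \<partial>lborel) \<le> (\<integral>\<^sup>+ s. g s \<partial>lborel)"
        by (intro nn_integral_mono) (simp only: area_slice[symmetric])
      then show "area F \<le> (\<integral>\<^sup>+ s. g s \<partial>lborel)"
        by (simp only: int)
    qed
  qed
qed

definition base_cube :: "'a::euclidean_space \<Rightarrow> 'a set" where
  "base_cube b = cbox 0 (One - b)"

lemma mem_base_cube:
  assumes "b \<in> Basis"
  shows "x \<in> base_cube b \<longleftrightarrow> x \<bullet> b = 0 \<and> (\<forall>i\<in>Basis - {b}. 0 \<le> x \<bullet> i \<and> x \<bullet> i \<le> 1)"
  using assms by (auto simp: base_cube_def mem_box inner_diff_left inner_Basis)

lemma prism_base_cube: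
  assumes b: "b \<in> Basis"
  shows "prism b (base_cube b) = cbox 0 One"
proof
  show "prism b (base_cube b) \<subseteq> cbox 0 One"
  proof
    fix x assume "x \<in> prism b (base_cube b)"
    then obtain y s where y: "y \<in> base_cube b" "s \<in> {0..1}" "x = y + s *\<^sub>R b"
      by (auto simp: prism_def)
    then show "x \<in> cbox 0 One"
      using b by (auto simp: mem_box mem_base_cube inner_add_left inner_Basis)
  qed
  show "cbox 0 One \<subseteq> prism b (base_cube b)"
  proof
    fix x :: 'a assume x: "x \<in> cbox 0 One"
    have "x - (x \<bullet> b) *\<^sub>R b \<in> base_cube b" "x \<bullet> b \<in> {0..1}"
      using x b by (auto simp: mem_box mem_base_cube inner_diff_left inner_Basis)
    then show "x \<in> prism b (base_cube b)"
      unfolding prism_def by (intro CollectI exI[of _ "x - (x \<bullet> b) *\<^sub>R b"] exI[of _ "x \<bullet> b"]) auto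
  qed
qed

text \<open>The cube is a union of \<open>2 ^ (n - 1)\<close> copies of itself scaled by \<open>1/2\<close>. Hence the premeasure at
  scale \<open>\<delta>\<close> is at most the premeasure at scale \<open>2 * \<delta>\<close>, and after finitely many doublings the cube
  itself is an admissible cover.\<close>

lemma area_base_cube_finite:
  fixes b :: "'a::euclidean_space"
  assumes b: "b \<in> Basis"
  shows "area (base_cube b) < top"
proof -
  let ?d = "DIM('a) - 1" and ?B = "base_cube b"
  have bdd: "bounded ?B"
    by (simp add: base_cube_def)
  have half: "hausdorff_premeasure ?d \<delta> ?B \<le> hausdorff_premeasure ?d (2 * \<delta>) ?B" if "\<delta> > 0" for \<delta>
  proof -
    define J where "J = Pow (Basis - {b})"
    have "?B \<subseteq> (\<Union>I\<in>J. (\<lambda>x. (1/2) *\<^sub>R (\<Sum>I) + (1/2) *\<^sub>R x) ` ?B)"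
    proof
      fix x assume x: "x \<in> ?B"
      define I where "I = {i \<in> Basis - {b}. x \<bullet> i > 1/2}"
      define y where "y = 2 *\<^sub>R x - \<Sum>I"
      have "I \<in> J"
        by (auto simp: I_def J_def)
      have sumI: "(\<Sum>I) \<bullet> i = (if i \<in> I then 1 else 0)" if "i \<in> Basis" for i
      proof -
        have "finite I"
          by (rule finite_subset[of _ Basis]) (auto simp: I_def)
        have "(\<Sum>I) \<bullet> i = (\<Sum>j\<in>I. if j = i then 1 else 0)"
          unfolding inner_sum_left using that by (intro sum.cong) (auto simp: I_def inner_Basis)
        then show ?thesis
          using \<open>finite I\<close> by simp
      qed
      have "y \<in> ?B"
      proof -
        have "y \<bullet> i = 2 * (x \<bullet> i) - (if i \<in> I then 1 else 0)" if "i \<in> Basis" for i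
          using that by (simp add: y_def inner_diff_left sumI)
        then show ?thesis
          using x b by (auto simp: mem_base_cube I_def)
      qed
      moreover have "x = (1/2) *\<^sub>R (\<Sum>I) + (1/2) *\<^sub>R y"
        by (simp add: y_def scaleR_diff_right)
      ultimately show "x \<in> (\<Union>I\<in>J. (\<lambda>x. (1/2) *\<^sub>R (\<Sum>I) + (1/2) *\<^sub>R x) ` ?B)"
        using \<open>I \<in> J\<close> by blast
    qed
    then have "hausdorff_premeasure ?d \<delta> ?B
        \<le> hausdorff_premeasure ?d \<delta> (\<Union>I\<in>J. (\<lambda>x. (1/2) *\<^sub>R (\<Sum>I) + (1/2) *\<^sub>R x) ` ?B)"
      by (rule hausdorff_premeasure_mono)
    also have "\<dots> \<le> (\<Sum>I\<in>J. hausdorff_premeasure ?d \<delta> ((\<lambda>x. (1/2) *\<^sub>R (\<Sum>I) + (1/2) *\<^sub>R x) ` ?B))"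
      using that by (intro hausdorff_premeasure_finite_UN) (auto simp: J_def)
    also have "\<dots> \<le> (\<Sum>I\<in>J. ennreal ((1/2) ^ ?d) * hausdorff_premeasure ?d (2 * \<delta>) ?B)"
    proof (rule sum_mono)
      fix I assume "I \<in> J"
      show "hausdorff_premeasure ?d \<delta> ((\<lambda>x. (1/2) *\<^sub>R (\<Sum>I) + (1/2) *\<^sub>R x) ` ?B)
          \<le> ennreal ((1/2) ^ ?d) * hausdorff_premeasure ?d (2 * \<delta>) ?B"
        using hausdorff_premeasure_lipschitz_image[of ?B "\<lambda>x. (1/2) *\<^sub>R (\<Sum>I) + (1/2) *\<^sub>R x" "1/2",
            where \<delta> = "2 * \<delta>" and d = ?d]
        by (simp add: dist_norm scaleR_diff_right[symmetric])
    qed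
    also have "\<dots> = ennreal (2 ^ ?d * (1/2) ^ ?d) * hausdorff_premeasure ?d (2 * \<delta>) ?B"
    proof -
      have "real (card J) = 2 ^ ?d"
        using b by (simp add: J_def card_Pow)
      then show ?thesis
        by (simp add: ennreal_of_nat_eq_real_of_nat ennreal_mult mult.assoc)
    qed
    also have "(2::real) ^ ?d * (1/2) ^ ?d = 1"
      by (simp add: power_mult_distrib[symmetric])
    finally show ?thesis by simp
  qed
  have doubling: "hausdorff_premeasure ?d \<delta> ?B \<le> hausdorff_premeasure ?d (2 ^ k * \<delta>) ?B" if "\<delta> > 0" for \<delta> k
  proof (induction k)
    case (Suc k)
    have "hausdorff_premeasure ?d (2 ^ k * \<delta>) ?B \<le> hausdorff_premeasure ?d (2 * (2 ^ k * \<delta>)) ?B"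
      using that by (intro half) simp
    with Suc show ?case
      unfolding power_Suc mult.assoc by (rule order_trans)
  qed simp
  have "hausdorff_premeasure ?d \<delta> ?B \<le> hausdorff_weight ?d ?B" if "\<delta> > 0" for \<delta>
  proof -
    obtain k where k: "diameter ?B / \<delta> < 2 ^ k"
      using real_arch_pow[of 2 "diameter ?B / \<delta>"] by auto
    then have k: "diameter ?B \<le> 2 ^ k * \<delta>"
      using that by (simp add: field_simps)
    have "hausdorff_premeasure ?d \<delta> ?B \<le> hausdorff_premeasure ?d (2 ^ k * \<delta>) ?B"
      using that by (rule doubling)
    also have "\<dots> \<le> (\<Sum>i::nat. hausdorff_weight ?d (if i = 0 then ?B else {}))"
      by (rule hausdorff_premeasure_le) (use k bdd that in \<open>auto simp: diameter_empty\<close>)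
    also have "\<dots> = (\<Sum>i<Suc 0. hausdorff_weight ?d (if i = 0 then ?B else {}))"
      by (rule suminf_finite) auto
    finally show ?thesis by simp
  qed
  then have "area ?B \<le> hausdorff_weight ?d ?B"
    by (rule hausdorff_measure_least)
  also have "\<dots> < top"
    by (simp add: hausdorff_weight_def)
  finally show ?thesis .
qed

text \<open>A set of diameter \<open>r\<close> has its prism inside a box of volume \<open>(2 * r) ^ (n - 1)\<close>, and the boxes of a
  cover of the base must fill up the unit cube. This crude count gives
  the lower bound \<open>\<omega> / 4 ^ (n - 1)\<close>.\<close>

lemma area_base_cube_pos:
  fixes b :: "'a::euclidean_space"
  assumes b: "b \<in> Basis"
  shows "area (base_cube b) > 0"
proof -
  let ?d = "DIM('a) - 1" and ?B = "base_cube b"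
  define \<omega> where "\<omega> = unit_ball_vol (real ?d)"
  have "\<omega> > 0"
    by (simp add: \<omega>_def)
  have cardD: "card (Basis - {b}) = ?d"
    using b by simp
  have "ennreal (\<omega> / 4 ^ ?d) \<le> hausdorff_premeasure ?d 1 ?B"
  proof (rule hausdorff_premeasure_greatest)
    fix C :: "nat \<Rightarrow> 'a set"
    assume C: "?B \<subseteq> (\<Union>i. C i)" "\<And>i. bounded (C i)"
    define p where "p i = (SOME x. x \<in> C i)" for i
    define r where "r i = diameter (C i)" for i
    define lo where "lo i = (\<Sum>j\<in>Basis. (if j = b then 0 else p i \<bullet> j - r i) *\<^sub>R j)" for i
    define hi where "hi i = (\<Sum>j\<in>Basis. (if j = b then 1 else p i \<bullet> j + r i) *\<^sub>R j)" for i
    define T where "T i = (if C i = {} then {} else cbox (lo i) (hi i))" for i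
    have r0: "r i \<ge> 0" for i
      by (simp add: r_def diameter_ge_0 C)
    have lohi: "lo i \<bullet> j = (if j = b then 0 else p i \<bullet> j - r i)"
               "hi i \<bullet> j = (if j = b then 1 else p i \<bullet> j + r i)" if "j \<in> Basis" for i j
      using that by (simp_all add: lo_def hi_def)
    have vol_T: "emeasure lebesgue (T i) \<le> ennreal (4 ^ ?d / \<omega>) * hausdorff_weight ?d (C i)" for i
    proof (cases "C i = {}")
      case False
      have "(\<Prod>j\<in>Basis. (hi i - lo i) \<bullet> j) = (\<Prod>j\<in>Basis - {b}. (hi i - lo i) \<bullet> j)"
        using b by (subst prod.remove[of _ b]) (auto simp: inner_diff_left lohi)
      also have "\<dots> = (\<Prod>j\<in>Basis - {b}. 2 * r i)"
        by (rule prod.cong) (auto simp: inner_diff_left lohi)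
      also have "\<dots> = (2 * r i) ^ ?d"
        by (simp add: cardD)
      also have "\<dots> = 4 ^ ?d / \<omega> * (\<omega> * (r i / 2) ^ ?d)"
      proof -
        have "(2 * r i) ^ ?d = (4 * (r i / 2)) ^ ?d"
          by simp
        also have "\<dots> = 4 ^ ?d * (r i / 2) ^ ?d"
          by (rule power_mult_distrib)
        finally show ?thesis
          using \<open>\<omega> > 0\<close> by simp
      qed
      finally have "(\<Prod>j\<in>Basis. (hi i - lo i) \<bullet> j) = 4 ^ ?d / \<omega> * (\<omega> * (r i / 2) ^ ?d)" .
      moreover have "emeasure lebesgue (T i) = ennreal (\<Prod>j\<in>Basis. (hi i - lo i) \<bullet> j)"
        using False r0[of i] by (auto simp: T_def emeasure_lborel_cbox_eq lohi)
      moreover have "hausdorff_weight ?d (C i) = ennreal (\<omega> * (r i / 2) ^ ?d)"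
        using False by (simp only: hausdorff_weight_def r_def \<omega>_def if_False)
      moreover have "ennreal (4 ^ ?d / \<omega> * (\<omega> * (r i / 2) ^ ?d))
          = ennreal (4 ^ ?d / \<omega>) * ennreal (\<omega> * (r i / 2) ^ ?d)"
        using r0[of i] \<open>\<omega> > 0\<close> by (intro ennreal_mult) auto
      ultimately show ?thesis
        by (simp only: order_refl)
    qed (simp add: T_def)
    have "cbox 0 One \<subseteq> (\<Union>i. T i)"
    proof
      fix y :: 'a assume "y \<in> cbox 0 One"
      then obtain x s where x: "x \<in> ?B" "s \<in> {0..1}" "y = x + s *\<^sub>R b"
        unfolding prism_base_cube[OF b, symmetric] by (auto simp: prism_def)
      then obtain i where i: "x \<in> C i"
        using C by blast
      then have "p i \<in> C i"
        unfolding p_def by (rule someI)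
      then have "norm (x - p i) \<le> r i"
        unfolding r_def dist_norm[symmetric] using i C(2) by (intro diameter_bounded_bound)
      then have "\<bar>x \<bullet> j - p i \<bullet> j\<bar> \<le> r i" if "j \<in> Basis" for j
        using Basis_le_norm[OF that, of "x - p i"] by (simp add: inner_diff_left)
      moreover have "x \<bullet> b = 0"
        using x(1) b by (simp add: mem_base_cube)
      ultimately have "y \<in> cbox (lo i) (hi i)"
        using x b by (auto simp: mem_box lohi inner_add_left inner_Basis abs_le_iff) (smt (verit))+
      then show "y \<in> (\<Union>i. T i)"
        using i by (auto simp: T_def)
    qed
    then have "emeasure lebesgue (cbox 0 One :: 'a set) \<le> emeasure lebesgue (\<Union>i. T i)"
      by (intro emeasure_mono) (auto simp: T_def)
    also have "\<dots> \<le> (\<Sum>i. emeasure lebesgue (T i))"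
      by (intro emeasure_subadditive_countably) (auto simp: T_def)
    also have "\<dots> \<le> (\<Sum>i. ennreal (4 ^ ?d / \<omega>) * hausdorff_weight ?d (C i))"
      by (intro suminf_le vol_T) auto
    finally have "1 \<le> ennreal (4 ^ ?d / \<omega>) * (\<Sum>i. hausdorff_weight ?d (C i))"
      by (simp add: emeasure_lborel_cbox_eq)
    then have "ennreal (\<omega> / 4 ^ ?d) * 1
        \<le> ennreal (\<omega> / 4 ^ ?d) * (ennreal (4 ^ ?d / \<omega>) * (\<Sum>i. hausdorff_weight ?d (C i)))"
      by (rule mult_left_mono) simp
    also have "\<dots> = (\<Sum>i. hausdorff_weight ?d (C i))"
      using \<open>\<omega> > 0\<close> by (simp add: mult.assoc[symmetric] ennreal_mult[symmetric])
    finally show "ennreal (\<omega> / 4 ^ ?d) \<le> (\<Sum>i. hausdorff_weight ?d (C i))" by simp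
  qed
  also have "\<dots> \<le> area ?B"
    by (rule hausdorff_premeasure_le_measure) simp
  finally show ?thesis
    using \<open>\<omega> > 0\<close> by (auto intro: less_le_trans[rotated])
qed

text \<open>The sliced area obeys the hypotheses of \<open>proportional_to_lebesgue\<close> and, on a prism over \<open>F\<close>, it
  is the area of \<open>F\<close>. A single constant serves all hyperplanes because a rotation carries each of
  them to a hyperplane orthogonal to a fixed basis vector.\<close>

lemma area_of_flat_set:
  "\<exists>\<kappa>>0. \<forall>u \<alpha>. \<forall>F::'a::euclidean_space set. norm u = 1 \<longrightarrow> compact F \<longrightarrow> F \<subseteq> {x. x \<bullet> u = \<alpha>}
      \<longrightarrow> area F = ennreal (\<kappa> * measure lebesgue (prism u F))"
proof -
  obtain b :: 'a where b: "b \<in> Basis"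
    using nonempty_Basis by blast
  have nb: "norm b = 1"
    using b by simp
  have "sliced_area b (cbox 0 One) = area (base_cube b)"
  proof -
    have "base_cube b \<subseteq> {x. x \<bullet> b = 0}"
      using b by (auto simp: mem_base_cube)
    from sliced_area_prism[OF nb this] show ?thesis
      by (simp only: prism_base_cube[OF b])
  qed
  then obtain \<kappa> where \<kappa>: "sliced_area b (cbox 0 One) = ennreal \<kappa>" "\<kappa> > 0"
    using area_base_cube_finite[OF b] area_base_cube_pos[OF b]
    by (metis ennreal_cases ennreal_0 less_irrefl not_less order_le_less ennreal_neg)
  have main: "sliced_area b S = ennreal \<kappa> * emeasure lebesgue S" if "S \<in> sets borel" "bounded S" for S
    unfolding \<kappa>(1)[symmetric]
    by (rule proportional_to_lebesgue)
       (use that \<kappa> in \<open>auto intro: sliced_area_mono sliced_area_UN sliced_area_affinity_le simp: sliced_area_empty\<close>)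
  have "area F = ennreal (\<kappa> * measure lebesgue (prism u F))"
    if u: "norm u = 1" and F: "compact F" "F \<subseteq> {x. x \<bullet> u = \<alpha>}" for u :: 'a and \<alpha> F
  proof -
    obtain R where R: "orthogonal_transformation R" "R u = b"
      using orthogonal_transformation_between_units[OF u nb] .
    have "linear R"
      using R by (simp add: orthogonal_transformation_linear)
    have iso: "dist (R x) (R y) = dist x y" for x y
      using R by (metis dist_norm linear_diff[OF \<open>linear R\<close>] orthogonal_transformation_norm)
    have RF: "R ` F \<subseteq> {x. x \<bullet> b = \<alpha>}"
      using F(2) R by (auto simp: orthogonal_transformation_def)
    have img: "prism b (R ` F) = R ` prism u F"
      unfolding prism_eq_image using R
      by (force simp: image_image linear_add[OF \<open>linear R\<close>] linear_scale[OF \<open>linear R\<close>] image_iff)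
    have P: "prism u F \<in> sets borel" "bounded (prism u F)"
      using compact_prism[OF F(1), of u] by (auto simp: compact_imp_bounded borel_compact)
    have cR: "compact (R ` F)"
      using F(1) \<open>linear R\<close> by (intro compact_continuous_image linear_continuous_on) (auto simp: linear_conv_bounded_linear)
    have P': "prism b (R ` F) \<in> sets borel" "bounded (prism b (R ` F))"
      using compact_prism[OF cR, of b] by (auto simp: compact_imp_bounded borel_compact)
    have "area F = area (R ` F)"
      by (rule hausdorff_measure_isometry_image[symmetric]) (rule iso)
    also have "\<dots> = sliced_area b (prism b (R ` F))"
      by (rule sliced_area_prism[OF nb RF, symmetric])
    also have "\<dots> = ennreal \<kappa> * emeasure lebesgue (R ` prism u F)"
      using main[OF P'] by (simp add: img)
    also have "emeasure lebesgue (R ` prism u F) = emeasure lebesgue (prism u F)"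
      using scales_volumeD[OF scales_volume_isometry[OF R(1)] P] by simp
    also have "\<dots> = ennreal (measure lebesgue (prism u F))"
      using lmeasurable_compact[OF compact_prism[OF F(1)]] by (rule emeasure_eq_measure2)
    finally show ?thesis
      using \<kappa>(2) by (simp add: ennreal_mult)
  qed
  with \<kappa>(2) show ?thesis by blast
qed

section \<open>Stretching flat sets\<close>

lemma orthogonal_affinity_0_adjoint:
  "orthogonal_affinity 0 v t x \<bullet> y = x \<bullet> orthogonal_affinity 0 v t y"
  by (simp add: orthogonal_affinity_0_eq inner_add_left inner_add_right inner_commute algebra_simps)

lemma prism_linear_image: "linear f \<Longrightarrow> prism (f w) (f ` F) = f ` prism w F"
  unfolding prism_eq_image by (force simp: image_image linear_add linear_scale image_iff)

lemma compact_linear_image_of_linear: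
  fixes f :: "'a::euclidean_space \<Rightarrow> 'b::euclidean_space"
  shows "linear f \<Longrightarrow> compact S \<Longrightarrow> compact (f ` S)"
  by (intro compact_continuous_image linear_continuous_on) (auto simp: linear_conv_bounded_linear)

text \<open>The linear map that fixes the hyperplane orthogonal to \<open>u\<close> and takes \<open>u\<close> to \<open>w\<close> carries the right
  prism to a translate of the oblique one; the translation accounts for the offset \<open>\<alpha>\<close>.\<close>

lemma measure_prism_oblique:
  fixes F :: "'a::euclidean_space set"
  assumes "norm u = 1" "w \<bullet> u > 0" "compact F" and F: "F \<subseteq> {x. x \<bullet> u = \<alpha>}"
  shows "measure lebesgue (prism w F) = (w \<bullet> u) * measure lebesgue (prism u F)"
proof -
  define f where "f x = x + (x \<bullet> u) *\<^sub>R (w - u)" for x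
  have uu: "u \<bullet> u = 1"
    using assms by (simp add: norm_eq_1)
  have f_val: "f (x + s *\<^sub>R u) = (\<alpha> *\<^sub>R (w - u)) + (x + s *\<^sub>R w)" if "x \<in> F" for x s
  proof -
    have "x \<bullet> u = \<alpha>"
      using F that by auto
    then show ?thesis
      using uu by (simp add: f_def inner_add_left algebra_simps)
  qed
  have "f ` prism u F = (+) (\<alpha> *\<^sub>R (w - u)) ` prism w F"
    unfolding prism_eq_image image_image by (rule image_cong) (auto simp: f_val)
  then have "measure lebesgue (prism w F) = measure lebesgue (f ` prism u F)"
    by (simp add: measure_translation)
  also have "\<dots> = (w \<bullet> u) * measure lebesgue (prism u F)"
    unfolding f_def
    using compact_prism[OF assms(3), of u]
    by (intro scales_volume_measure scales_volume_oblique assms) (auto simp: compact_imp_bounded borel_compact)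
  finally show ?thesis .
qed

text \<open>The vector \<open>n\<close> is \<open>t\<close> times the image of \<open>u\<close> under the inverse of the self-adjoint stretching map
  \<open>A\<close>, and hence normal to the image of the hyperplane. The map \<open>A\<close> takes the prism over \<open>F\<close> to an
  oblique prism over the image of \<open>F\<close> of height \<open>t / norm n\<close> and multiplies its volume by \<open>t\<close>, so the
  base has grown by the factor \<open>norm n\<close>.\<close>

lemma measure_prism_orthogonal_affinity:
  fixes F :: "'a::euclidean_space set"
  assumes v: "norm v = 1" and u: "norm u = 1" and "t > 0" and "compact F" and F: "F \<subseteq> {x. x \<bullet> u = \<alpha>}"
  defines "n \<equiv> t *\<^sub>R u + ((1 - t) * (u \<bullet> v)) *\<^sub>R v"
  shows "n \<noteq> 0" 
    and "orthogonal_affinity 0 v t ` F \<subseteq> {x. x \<bullet> (n /\<^sub>R norm n) = t * \<alpha> / norm n}"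
    and "measure lebesgue (prism (n /\<^sub>R norm n) (orthogonal_affinity 0 v t ` F))
           = norm n * measure lebesgue (prism u F)"
proof -
  let ?A = "orthogonal_affinity 0 v t"
  have An: "?A n = t *\<^sub>R u"
  proof -
    have "v \<bullet> v = 1"
      using v by (simp add: norm_eq_1)
    then have "v \<bullet> n = u \<bullet> v"
      by (simp add: n_def inner_add_right inner_commute algebra_simps)
    then show ?thesis
      by (simp add: orthogonal_affinity_0_eq n_def algebra_simps)
  qed
  have A_n: "?A x \<bullet> n = t * (x \<bullet> u)" for x
    by (simp add: orthogonal_affinity_0_adjoint An)
  have uu: "u \<bullet> u = 1"
    using u by (simp add: norm_eq_1)
  show n0: "n \<noteq> 0"
    using A_n[of u] uu \<open>t > 0\<close> by auto
  define u' where "u' = n /\<^sub>R norm n"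
  have u': "norm u' = 1"
    using n0 by (simp add: u'_def)
  have A_u': "?A x \<bullet> u' = t * (x \<bullet> u) / norm n" for x
    by (simp add: u'_def A_n field_simps)
  have flat: "?A ` F \<subseteq> {x. x \<bullet> u' = t * \<alpha> / norm n}"
    using F by (auto simp: A_u')
  then show "?A ` F \<subseteq> {x. x \<bullet> (n /\<^sub>R norm n) = t * \<alpha> / norm n}"
    by (simp add: u'_def)
  have cA: "compact (?A ` F)"
    by (intro compact_linear_image_of_linear linear_orthogonal_affinity_0 \<open>compact F\<close>)
  have pos: "?A u \<bullet> u' > 0"
    using n0 \<open>t > 0\<close> uu by (simp add: A_u')
  have "t * measure lebesgue (prism u F) = measure lebesgue (prism (?A u) (?A ` F))"
    using compact_prism[OF \<open>compact F\<close>, of u]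
    by (simp add: prism_linear_image[OF linear_orthogonal_affinity_0] compact_imp_bounded borel_compact
        scales_volume_measure[OF scales_volume_orthogonal_affinity[OF v \<open>t > 0\<close>]])
  also have "\<dots> = (t / norm n) * measure lebesgue (prism u' (?A ` F))"
    using measure_prism_oblique[OF u' pos cA flat] uu by (simp add: A_u')
  finally show "measure lebesgue (prism (n /\<^sub>R norm n) (?A ` F)) = norm n * measure lebesgue (prism u F)"
    using n0 \<open>t > 0\<close> by (simp add: u'_def field_simps)
qed

text \<open>The growth factor is the norm of an affine function of \<open>t\<close>. This is the source of all convexity in
  the proof.\<close>

lemma area_of_stretched_flat_set:
  "\<exists>\<kappa>>0. \<forall>u \<alpha>. \<forall>F::'a::euclidean_space set. \<forall>v t. norm u = 1 \<longrightarrow> compact F \<longrightarrow> F \<subseteq> {x. x \<bullet> u = \<alpha>}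
      \<longrightarrow> norm v = 1 \<longrightarrow> t > 0
      \<longrightarrow> area (orthogonal_affinity 0 v t ` F)
            = ennreal (\<kappa> * measure lebesgue (prism u F) * norm (t *\<^sub>R u + ((1 - t) * (u \<bullet> v)) *\<^sub>R v))"
proof -
  obtain \<kappa> where \<kappa>: "\<kappa> > 0" "\<And>u \<alpha> F. norm u = 1 \<Longrightarrow> compact F \<Longrightarrow> F \<subseteq> {x::'a. x \<bullet> u = \<alpha>}
      \<Longrightarrow> area F = ennreal (\<kappa> * measure lebesgue (prism u F))"
    using area_of_flat_set by blast
  have "area (orthogonal_affinity 0 v t ` F)
      = ennreal (\<kappa> * measure lebesgue (prism u F) * norm (t *\<^sub>R u + ((1 - t) * (u \<bullet> v)) *\<^sub>R v))"
    if *: "norm v = 1" "norm u = 1" "t > 0" "compact F" "F \<subseteq> {x. x \<bullet> u = \<alpha>}" for u v :: 'a and \<alpha> t F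
    by (subst \<kappa>(2)[OF _ _ measure_prism_orthogonal_affinity(2)[OF *]])
       (use measure_prism_orthogonal_affinity(1,3)[OF *] *(4) in
        \<open>auto simp: mult_ac intro!: compact_linear_image_of_linear linear_orthogonal_affinity_0\<close>)
  with \<kappa>(1) show ?thesis by blast
qed

section \<open>Contractions of boundaries\<close>

lemma ray_meets_frontier:
  fixes K :: "'a::euclidean_space set"
  assumes "bounded K" "x \<in> K" "a \<noteq> 0"
  obtains s where "s \<ge> 0" "x + s *\<^sub>R a \<in> frontier K"
proof -
  let ?T = "(\<lambda>s. x + s *\<^sub>R a) ` {0..}"
  obtain B where B: "\<And>y. y \<in> K \<Longrightarrow> norm y \<le> B"
    using assms(1) by (auto simp: bounded_iff)
  define s where "s = (B + norm x + 1) / norm a"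
  have "B \<ge> 0"
    using B[OF assms(2)] norm_ge_zero order_trans by blast
  then have s0: "s \<ge> 0"
    by (simp add: s_def add_nonneg_nonneg)
  have "norm (s *\<^sub>R a) = B + norm x + 1"
    using assms(3) \<open>B \<ge> 0\<close> by (simp add: s_def abs_of_nonneg add_nonneg_nonneg)
  then have "norm (x + s *\<^sub>R a) > B"
    using norm_triangle_ineq4[of "x + s *\<^sub>R a" x] by simp
  then have "x + s *\<^sub>R a \<in> ?T - K"
    using s0 B[of "x + s *\<^sub>R a"] by force
  moreover have "x \<in> ?T \<inter> K"
    using assms(2) by (auto intro!: image_eqI[of _ _ 0])
  moreover have "connected ?T"
    by (intro connected_continuous_image continuous_intros) auto
  ultimately have "?T \<inter> frontier K \<noteq> {}"
    using connected_Int_frontier[of ?T K] by blast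
  then show ?thesis
    using that by auto
qed

lemma norm_le_norm_add_of_inner_nonneg:
  fixes p q :: "'a::real_inner"
  assumes "p \<bullet> q \<ge> 0"
  shows "norm p \<le> norm (p + q)"
proof -
  have "(p + q) \<bullet> (p + q) = p \<bullet> p + 2 * (p \<bullet> q) + q \<bullet> q"
    by (simp add: inner_add_left inner_add_right inner_commute)
  then show ?thesis
    using assms inner_ge_zero[of q] unfolding norm_le by linarith
qed

text \<open>The nearest-point map of \<open>C\<close> is a contraction. It maps the boundary of \<open>K\<close> onto the boundary of
  \<open>C\<close>: a boundary point \<open>x\<close> of \<open>C\<close> is the nearest point of every point on the ray that leaves \<open>C\<close>
  at \<open>x\<close> orthogonally to a supporting hyperplane, and this ray meets the boundary of \<open>K\<close>.\<close>

lemma area_frontier_mono: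
  fixes C K :: "'a::euclidean_space set"
  assumes C: "compact C" "convex C" "interior C \<noteq> {}" and "C \<subseteq> K" "bounded K"
  shows "area (frontier C) \<le> area (frontier K)"
proof -
  have ne: "C \<noteq> {}"
    using C interior_subset by blast
  have "frontier C \<subseteq> closest_point C ` frontier K"
  proof
    fix x assume x: "x \<in> frontier C"
    then have xC: "x \<in> C" "x \<notin> interior C"
      using C(1) by (auto simp: frontier_def compact_imp_closed)
    then have "x \<notin> rel_interior C"
      by (simp add: rel_interior_nonempty_interior[OF C(3)])
    then obtain a where a: "a \<noteq> 0" "\<And>y. y \<in> C \<Longrightarrow> a \<bullet> x \<le> a \<bullet> y"
      using supporting_hyperplane_rel_boundary[OF C(2) xC(1)] by metis
    obtain s where s: "s \<ge> 0" "x + s *\<^sub>R (- a) \<in> frontier K"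
      using ray_meets_frontier[of K x "- a"] assms xC a(1) by (metis neg_equal_0_iff_equal subsetD)
    define y where "y = x + s *\<^sub>R (- a)"
    have "dist y x \<le> dist y z" if "z \<in> C" for z
    proof -
      have "0 \<le> s * (a \<bullet> (z - x))"
        using s(1) a(2)[OF that] by (simp add: inner_diff_right)
      then have "norm (s *\<^sub>R a) \<le> norm (s *\<^sub>R a + (z - x))"
        using norm_le_norm_add_of_inner_nonneg[of "s *\<^sub>R a" "z - x"] by simp
      moreover have "dist y z = norm (s *\<^sub>R a + (z - x))"
      proof -
        have "y - z = - (s *\<^sub>R a + (z - x))"
          by (simp add: y_def)
        then show ?thesis
          by (simp only: dist_norm norm_minus_cancel)
      qed
      ultimately show ?thesis
        by (simp add: y_def dist_norm)
    qed
    then have "x = closest_point C y"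
      by (intro closest_point_unique[OF C(2) compact_imp_closed[OF C(1)] xC(1)] ballI)
    then show "x \<in> closest_point C ` frontier K"
      using s(2) unfolding y_def by (rule image_eqI)
  qed
  then have "area (frontier C) \<le> area (closest_point C ` frontier K)"
    by (rule hausdorff_measure_mono)
  also have "\<dots> \<le> area (frontier K)"
    using C ne by (intro hausdorff_measure_contraction_image closest_point_lipschitz) (auto simp: compact_imp_closed)
  finally show ?thesis .
qed

text \<open>The orthogonal projection onto the hyperplane is a contraction, and over each point of \<open>F\<close> there
  is a boundary point of \<open>K\<close>.\<close>

lemma area_section_le_area_frontier:
  fixes K :: "'a::euclidean_space set"
  assumes u: "norm u = 1" and F: "F \<subseteq> {x. x \<bullet> u = \<alpha>}" "F \<subseteq> K" and "bounded K"
  shows "area F \<le> area (frontier K)"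
proof -
  have uu: "u \<bullet> u = 1"
    using u by (simp add: norm_eq_1)
  define p where "p y = y - (y \<bullet> u - \<alpha>) *\<^sub>R u" for y
  have "F \<subseteq> p ` frontier K"
  proof
    fix x assume "x \<in> F"
    then obtain s where s: "x + s *\<^sub>R u \<in> frontier K"
      using ray_meets_frontier[of K x u] assms by (metis norm_zero subsetD zero_neq_one)
    have "x \<bullet> u = \<alpha>"
      using \<open>x \<in> F\<close> F by auto
    then have "p (x + s *\<^sub>R u) = x"
      using uu by (simp add: p_def inner_add_left)
    with s show "x \<in> p ` frontier K"
      by (metis image_eqI)
  qed
  then have "area F \<le> area (p ` frontier K)"
    by (rule hausdorff_measure_mono)
  also have "\<dots> \<le> area (frontier K)"
  proof (rule hausdorff_measure_contraction_image)
    fix x y :: 'a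
    define d where "d = x - y"
    have "p x - p y = d - (d \<bullet> u) *\<^sub>R u"
      by (simp add: p_def d_def inner_diff_left algebra_simps)
    moreover have "norm (d - (d \<bullet> u) *\<^sub>R u) \<le> norm d"
    proof -
      define c where "c = d \<bullet> u"
      have "u \<bullet> d = c"
        by (simp add: c_def inner_commute)
      then have "(d - c *\<^sub>R u) \<bullet> (d - c *\<^sub>R u) = d \<bullet> d - c * c"
        by (simp add: inner_diff_left inner_diff_right uu c_def[symmetric])
      then show ?thesis
        by (simp add: norm_le c_def[symmetric])
    qed
    ultimately show "dist (p x) (p y) \<le> dist x y"
      by (simp add: dist_norm d_def)
  qed
  finally show ?thesis .
qed

section \<open>Polytopes\<close>

lemma ennreal_le_of_le_powers:
  assumes "\<And>r. r > 1 \<Longrightarrow> x \<le> ennreal (r ^ d) * y"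
  shows "x \<le> y"
proof (cases "y = top")
  case False
  then obtain b where b: "y = ennreal b" "b \<ge> 0"
    by (metis ennreal_cases)
  have "x \<le> ennreal (2 ^ d * b)"
    using assms[of 2] b by (simp add: ennreal_mult)
  then obtain a where a: "x = ennreal a" "a \<ge> 0"
    by (metis ennreal_cases ennreal_neq_top top.extremum_unique)
  have le: "a \<le> r ^ d * b" if "r > 1" for r
    using assms[OF that] a b that by (simp add: ennreal_mult[symmetric])
  have "((\<lambda>r. r ^ d * b) \<longlongrightarrow> 1 ^ d * b) (at_right (1::real))"
    by (intro tendsto_intros)
  then have "a \<le> 1 ^ d * b"
    by (rule tendsto_lowerbound) (auto simp: eventually_at_right_less le intro: eventually_at_rightI[of 1 2])
  then show ?thesis
    using a b by simp
qed simp

lemma frontier_linear_image: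
  fixes f :: "'a::euclidean_space \<Rightarrow> 'a"
  assumes "linear f" "inj f"
  shows "frontier (f ` S) = f ` frontier S"
  using assms
  by (simp add: frontier_def closure_injective_linear_image interior_injective_linear_image image_set_diff)

text \<open>One inequality is subadditivity. For the other one, shrink each facet towards one of its relative
  interior points by a factor \<open>1 / r\<close>: the shrunken facets are compact and disjoint, so their areas
  add up, and they have lost only the factor \<open>r ^ (n - 1)\<close>, which tends to 1.\<close>

lemma area_frontier_polytope_image:
  fixes P :: "'a::euclidean_space set" and f :: "'a \<Rightarrow> 'a"
  assumes P: "polytope P" "interior P \<noteq> {}" and f: "linear f" "inj f"
  shows "area (frontier (f ` P)) = (\<Sum>F | F facet_of P. area (f ` F))"
proof -
  let ?d = "DIM('a) - 1" and ?\<F> = "{F. F facet_of P}"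
  have fin: "finite ?\<F>"
    by (rule finite_polytope_facets[OF P(1)])
  have "frontier P = \<Union> ?\<F>"
    using rel_frontier_of_polyhedron[OF polytope_imp_polyhedron[OF P(1)]] P(2)
    by (simp add: rel_frontier_nonempty_interior)
  then have fr: "frontier (f ` P) = (\<Union>F\<in>?\<F>. f ` F)"
    by (simp add: frontier_linear_image[OF f] image_Union)
  have facet: "compact F" "convex F" "F \<noteq> {}" if "F \<in> ?\<F>" for F
    using that P(1) by (auto simp: facet_of_def face_of_polytope_polytope polytope_imp_compact polytope_imp_convex)
  then have "\<forall>F\<in>?\<F>. \<exists>a. a \<in> rel_interior F"
    by (metis all_not_in_conv rel_interior_eq_empty)
  then obtain c where c: "\<And>F. F \<in> ?\<F> \<Longrightarrow> c F \<in> rel_interior F"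
    by metis
  show ?thesis
  proof (rule antisym)
    show "area (frontier (f ` P)) \<le> (\<Sum>F\<in>?\<F>. area (f ` F))"
      unfolding fr by (rule hausdorff_measure_finite_UN[OF fin])
    show "(\<Sum>F\<in>?\<F>. area (f ` F)) \<le> area (frontier (f ` P))"
    proof (rule ennreal_le_of_le_powers)
      fix r :: real
      assume "r > 1"
      define \<epsilon> where "\<epsilon> = 1 - 1 / r"
      have \<epsilon>: "0 < \<epsilon>" "\<epsilon> < 1" "1 - \<epsilon> = 1 / r"
        using \<open>r > 1\<close> by (auto simp: \<epsilon>_def field_simps)
      define G where "G F = (\<lambda>x. x - \<epsilon> *\<^sub>R (x - c F)) ` F" for F
      have G_sub: "G F \<subseteq> rel_interior F" if "F \<in> ?\<F>" for F
        unfolding G_def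
      proof (rule image_subsetI)
        fix x assume "x \<in> F"
        then show "x - \<epsilon> *\<^sub>R (x - c F) \<in> rel_interior F"
          using rel_interior_convex_shrink[OF facet(2)[OF that] c[OF that] _ \<epsilon>(1)] \<epsilon>(2) by simp
      qed
      have cG: "compact (f ` G F)" if "F \<in> ?\<F>" for F
        unfolding G_def using facet(1)[OF that] f(1)
        by (intro compact_linear_image_of_linear compact_continuous_image continuous_intros) auto
      have dis: "disjoint_family_on (\<lambda>F. f ` G F) ?\<F>"
        unfolding disjoint_family_on_def
      proof (intro ballI impI)
        fix F F' assume F: "F \<in> ?\<F>" "F' \<in> ?\<F>" "F \<noteq> F'"
        then have "rel_interior F \<inter> rel_interior F' = {}"
          using face_of_eq[of F P F'] by (auto simp: facet_of_def)
        then have "G F \<inter> G F' = {}"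
          using G_sub[OF F(1)] G_sub[OF F(2)] by blast
        then show "f ` G F \<inter> f ` G F' = {}"
          using f(2) by (metis image_Int image_empty)
      qed
      have "area (f ` F) \<le> ennreal (r ^ ?d) * area (f ` G F)" if "F \<in> ?\<F>" for F
      proof -
        have "(- (r * \<epsilon>)) *\<^sub>R c F + r *\<^sub>R (x - \<epsilon> *\<^sub>R (x - c F)) = x" for x
        proof -
          have "(- (r * \<epsilon>)) *\<^sub>R c F + r *\<^sub>R (x - \<epsilon> *\<^sub>R (x - c F)) = (r * (1 - \<epsilon>)) *\<^sub>R x"
            by (simp add: algebra_simps)
          then show ?thesis
            using \<epsilon> \<open>r > 1\<close> by simp
        qed
        then have "F = (\<lambda>x. (- (r * \<epsilon>)) *\<^sub>R c F + r *\<^sub>R x) ` G F"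
          by (simp add: G_def image_image)
        then have "f ` F = f ` (\<lambda>x. (- (r * \<epsilon>)) *\<^sub>R c F + r *\<^sub>R x) ` G F"
          by simp
        also have "\<dots> = (\<lambda>x. (- (r * \<epsilon>)) *\<^sub>R f (c F) + r *\<^sub>R x) ` (f ` G F)"
          by (simp only: image_image linear_add[OF f(1)] linear_scale[OF f(1)])
        finally have fF: "f ` F = (\<lambda>x. (- (r * \<epsilon>)) *\<^sub>R f (c F) + r *\<^sub>R x) ` (f ` G F)" .
        show ?thesis
          unfolding fF using \<open>r > 1\<close> by (intro hausdorff_measure_affinity_le) simp
      qed
      then have "(\<Sum>F\<in>?\<F>. area (f ` F)) \<le> (\<Sum>F\<in>?\<F>. ennreal (r ^ ?d) * area (f ` G F))"
        by (rule sum_mono)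
      also have "\<dots> = ennreal (r ^ ?d) * (\<Sum>F\<in>?\<F>. area (f ` G F))"
        by (simp add: sum_distrib_left)
      also have "(\<Sum>F\<in>?\<F>. area (f ` G F)) \<le> area (\<Union>F\<in>?\<F>. f ` G F)"
        by (rule hausdorff_measure_disjoint_compact[OF fin cG dis])
      also have "area (\<Union>F\<in>?\<F>. f ` G F) \<le> area (frontier (f ` P))"
        unfolding fr using G_sub rel_interior_subset by (intro hausdorff_measure_mono UN_mono image_mono) auto
      finally show "(\<Sum>F\<in>?\<F>. area (f ` F)) \<le> ennreal (r ^ ?d) * area (frontier (f ` P))"
        by (simp add: mult_left_mono)
    qed
  qed
qed

lemma facet_in_hyperplane:
  fixes P :: "'a::euclidean_space set"
  assumes "F facet_of P" "interior P \<noteq> {}"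
  obtains u \<alpha> where "norm u = 1" "F \<subseteq> {x. x \<bullet> u = \<alpha>}"
proof -
  have "aff_dim F = int (DIM('a) - 1)"
    using assms by (simp add: facet_of_def aff_dim_nonempty_interior of_nat_diff)
  then have "\<exists>a b. a \<noteq> 0 \<and> affine hull F = {x. a \<bullet> x = b}"
    by (rule iffD1[OF aff_dim_eq_hyperplane])
  then obtain a b where a: "a \<noteq> 0" "affine hull F = {x. a \<bullet> x = b}"
    by (elim exE conjE)
  show ?thesis
  proof (rule that[of "a /\<^sub>R norm a" "b / norm a"])
    show "norm (a /\<^sub>R norm a) = 1"
      using a by simp
    have "F \<subseteq> {x. a \<bullet> x = b}"
      using hull_subset[of F affine] a(2) by simp
    then show "F \<subseteq> {x. x \<bullet> (a /\<^sub>R norm a) = b / norm a}"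
      by (auto simp: inner_commute field_simps)
  qed
qed

lemma convex_on_finite_sum:
  fixes f :: "'i \<Rightarrow> 'a::real_vector \<Rightarrow> real"
  assumes "finite I" "convex S" "\<And>i. i \<in> I \<Longrightarrow> convex_on S (f i)"
  shows "convex_on S (\<lambda>x. \<Sum>i\<in>I. f i x)"
  using assms(1,3)
proof (induction I rule: finite_induct)
  case empty
  then show ?case
    using assms(2) by (simp add: convex_on_def)
next
  case (insert i I)
  then show ?case
    by (auto intro: convex_on_add)
qed

lemma area_stretched_polytope_convex:
  fixes P :: "'a::euclidean_space set"
  assumes P: "polytope P" "interior P \<noteq> {}" and v: "norm v = 1"
  obtains \<phi> :: "real \<Rightarrow> real" where "convex_on UNIV \<phi>" "\<And>t. \<phi> t \<ge> 0"
    "\<And>t. t > 0 \<Longrightarrow> area (frontier (orthogonal_affinity 0 v t ` P)) = ennreal (\<phi> t)"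
proof -
  let ?\<F> = "{F. F facet_of P}"
  obtain \<kappa> where \<kappa>: "\<kappa> > 0" "\<And>u \<alpha> F v t. norm u = 1 \<Longrightarrow> compact F \<Longrightarrow> F \<subseteq> {x::'a. x \<bullet> u = \<alpha>}
      \<Longrightarrow> norm v = 1 \<Longrightarrow> t > 0 \<Longrightarrow> area (orthogonal_affinity 0 v t ` F)
            = ennreal (\<kappa> * measure lebesgue (prism u F) * norm (t *\<^sub>R u + ((1 - t) * (u \<bullet> v)) *\<^sub>R v))"
    using area_of_stretched_flat_set by blast
  have "\<forall>F\<in>?\<F>. \<exists>u. norm u = 1 \<and> (\<exists>\<alpha>. F \<subseteq> {x. x \<bullet> u = \<alpha>})"
    using facet_in_hyperplane[OF _ P(2)] by (metis mem_Collect_eq)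
  then obtain u where u: "\<And>F. F \<in> ?\<F> \<Longrightarrow> norm (u F) = 1" "\<And>F. F \<in> ?\<F> \<Longrightarrow> \<exists>\<alpha>. F \<subseteq> {x. x \<bullet> u F = \<alpha>}"
    by metis
  have cpt: "compact F" if "F \<in> ?\<F>" for F
    using that P(1) by (auto simp: facet_of_def face_of_polytope_polytope polytope_imp_compact)
  define n where "n F t = t *\<^sub>R u F + ((1 - t) * (u F \<bullet> v)) *\<^sub>R v" for F t
  define \<phi> where "\<phi> t = (\<Sum>F\<in>?\<F>. (\<kappa> * measure lebesgue (prism (u F) F)) * norm (n F t))" for t
  show ?thesis
  proof (rule that[of \<phi>])
    show "\<phi> t \<ge> 0" for t
      unfolding \<phi>_def using \<kappa>(1) by (intro sum_nonneg mult_nonneg_nonneg) auto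
    have "convex_on UNIV (\<lambda>t. norm (n F t))" for F
    proof (rule convex_onI)
      fix a x y :: real
      assume a: "0 < a" "a < 1"
      have "n F ((1 - a) *\<^sub>R x + a *\<^sub>R y) = (1 - a) *\<^sub>R n F x + a *\<^sub>R n F y"
        by (simp add: n_def algebra_simps)
      then show "norm (n F ((1 - a) *\<^sub>R x + a *\<^sub>R y)) \<le> (1 - a) * norm (n F x) + a * norm (n F y)"
        using norm_triangle_ineq[of "(1 - a) *\<^sub>R n F x" "a *\<^sub>R n F y"] a by simp
    qed simp
    then show "convex_on UNIV \<phi>"
      unfolding \<phi>_def using \<kappa>(1) finite_polytope_facets[OF P(1)]
      by (intro convex_on_finite_sum convex_on_cmul) auto
    show "area (frontier (orthogonal_affinity 0 v t ` P)) = ennreal (\<phi> t)" if "t > 0" for t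
    proof -
      have "area (frontier (orthogonal_affinity 0 v t ` P)) = (\<Sum>F\<in>?\<F>. area (orthogonal_affinity 0 v t ` F))"
        using v \<open>t > 0\<close> by (intro area_frontier_polytope_image P linear_orthogonal_affinity_0 inj_orthogonal_affinity_0) auto
      also have "\<dots> = (\<Sum>F\<in>?\<F>. ennreal (\<kappa> * measure lebesgue (prism (u F) F) * norm (n F t)))"
      proof (rule sum.cong[OF refl])
        fix F assume F: "F \<in> ?\<F>"
        obtain \<alpha> where \<alpha>: "F \<subseteq> {x. x \<bullet> u F = \<alpha>}"
          using u(2)[OF F] by blast
        show "area (orthogonal_affinity 0 v t ` F) = ennreal (\<kappa> * measure lebesgue (prism (u F) F) * norm (n F t))"
          unfolding n_def by (rule \<kappa>(2)[OF u(1)[OF F] cpt[OF F] \<alpha> v \<open>t > 0\<close>])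
      qed
      also have "\<dots> = ennreal (\<phi> t)"
        unfolding \<phi>_def using \<kappa>(1) by (intro sum_ennreal) auto
      finally show ?thesis .
    qed
  qed
qed

section \<open>Convex bodies\<close>

text \<open>Finitely many boxes inside \<open>U\<close> cover \<open>K\<close>; take the convex hull of their vertices.\<close>

lemma polytope_between_compact_and_open:
  fixes K :: "'a::euclidean_space set"
  assumes "compact K" "open U" "convex U" "K \<subseteq> U"
  obtains P where "polytope P" "K \<subseteq> P" "P \<subseteq> U"
proof -
  have "\<exists>V. finite V \<and> V \<subseteq> U \<and> x \<in> interior (convex hull V)" if xK: "x \<in> K" for x
  proof -
    have "x \<in> U"
      using xK assms(4) by blast
    then obtain a b where ab: "cbox a b \<subseteq> U" "x \<in> box a b"
      using open_contains_cbox[OF assms(2)] by metis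
    obtain V where V: "finite V" "cbox a b = convex hull V"
      using closed_interval_as_convex_hull by metis
    have "V \<subseteq> U"
      using hull_subset[of V convex] ab(1) V(2) by simp
    moreover have "x \<in> interior (convex hull V)"
      using ab(2) by (simp add: V(2)[symmetric] interior_cbox)
    ultimately show ?thesis
      using V(1) by blast
  qed
  then obtain V where V: "\<And>x. x \<in> K \<Longrightarrow> finite (V x)" "\<And>x. x \<in> K \<Longrightarrow> V x \<subseteq> U"
      "\<And>x. x \<in> K \<Longrightarrow> x \<in> interior (convex hull V x)"
    by metis
  obtain T where T: "T \<subseteq> K" "finite T" "K \<subseteq> (\<Union>x\<in>T. interior (convex hull V x))"
    using compactE_image[OF assms(1), of K "\<lambda>x. interior (convex hull V x)"] V(3) by blast
  show ?thesis
  proof (rule that[of "convex hull (\<Union>x\<in>T. V x)"])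
    show "polytope (convex hull (\<Union>x\<in>T. V x))"
      unfolding polytope_def using T V(1) by blast
    have "interior (convex hull V x) \<subseteq> convex hull (\<Union>x\<in>T. V x)" if "x \<in> T" for x
      using interior_subset hull_mono[of "V x" "\<Union>x\<in>T. V x" convex] that by blast
    then show "K \<subseteq> convex hull (\<Union>x\<in>T. V x)"
      using T(3) by blast
    show "convex hull (\<Union>x\<in>T. V x) \<subseteq> U"
      using T(1) V(2) assms(3) by (intro hull_minimal) auto
  qed
qed

lemma subset_interior_scaling:
  fixes K :: "'a::euclidean_space set"
  assumes "convex K" "0 \<in> interior K" "r > 1"
  shows "K \<subseteq> interior ((*\<^sub>R) r ` K)"
proof
  fix x assume "x \<in> K"
  have "x - (1 - 1/r) *\<^sub>R (x - 0) \<in> interior K"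
    using assms \<open>x \<in> K\<close> by (intro mem_interior_convex_shrink) auto
  then have "(1/r) *\<^sub>R x \<in> interior K"
    by (simp add: algebra_simps)
  then have "x \<in> (*\<^sub>R) r ` interior K"
    using assms(3) by (intro image_eqI[of _ _ "(1/r) *\<^sub>R x"]) auto
  then show "x \<in> interior ((*\<^sub>R) r ` K)"
    using assms(3) interior_injective_linear_image[of "(*\<^sub>R) r" K] by (simp add: injective_scaleR)
qed

lemma measure_lebesgue_ball_pos: "e > 0 \<Longrightarrow> measure lebesgue (ball (x::'a::euclidean_space) e) > 0"
  by (subst measure_completion) (simp_all add: content_ball_pos)

text \<open>With the origin both on the fixed hyperplane and in the interior of the body, the stretching is
  linear, and \<open>K\<close> lies in the interior of each dilate \<open>r K\<close> with \<open>r > 1\<close>.\<close>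

locale stretching =
  fixes K :: "'a::euclidean_space set" and v :: 'a
  assumes K: "compact K" "convex K" "0 \<in> interior K" and v: "norm v = 1"
begin

abbreviation "A t \<equiv> orthogonal_affinity 0 v t"

lemma A_linear: "linear (A t)"
  by (rule linear_orthogonal_affinity_0)

lemma A_inj: "t > 0 \<Longrightarrow> inj (A t)"
  using inj_orthogonal_affinity_0[OF v] by simp

lemma interior_A: "t > 0 \<Longrightarrow> interior (A t ` S) = A t ` interior S"
  by (rule interior_injective_linear_image[OF A_linear A_inj])

text \<open>The chain \<open>K \<subseteq> P \<subseteq> r K\<close> with a polytope \<open>P\<close> survives all stretchings at once, since these are
  linear. Monotonicity of the boundary area then bounds the area for \<open>P\<close> on both sides, uniformly in
  \<open>t\<close>.\<close>

lemma sandwich: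
  assumes "r > 1"
  obtains \<phi> :: "real \<Rightarrow> real" where "convex_on UNIV \<phi>" "\<And>t. \<phi> t \<ge> 0"
    "\<And>t. t > 0 \<Longrightarrow> area (frontier (A t ` K)) \<le> ennreal (\<phi> t)"
    "\<And>t. t > 0 \<Longrightarrow> ennreal (\<phi> t) \<le> ennreal (r ^ (DIM('a) - 1)) * area (frontier (A t ` K))"
proof -
  obtain P where P: "polytope P" "K \<subseteq> P" "P \<subseteq> interior ((*\<^sub>R) r ` K)"
    using polytope_between_compact_and_open[OF K(1) open_interior _ subset_interior_scaling[OF K(2,3) assms]]
      K(2) convex_interior convex_scaling by metis
  have "0 \<in> interior P"
    using K(3) P(2) interior_mono by blast
  then have intP: "interior P \<noteq> {}" by blast
  obtain \<phi> :: "real \<Rightarrow> real" where \<phi>: "convex_on UNIV \<phi>" "\<And>t. \<phi> t \<ge> 0"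
    "\<And>t. t > 0 \<Longrightarrow> area (frontier (A t ` P)) = ennreal (\<phi> t)"
    using area_stretched_polytope_convex[OF P(1) intP v] by metis
  show ?thesis
  proof (rule that[OF \<phi>(1,2)])
    fix t :: real assume t: "t > 0"
    have cpt: "compact (A t ` K)" "compact (A t ` P)"
      using compact_linear_image_of_linear[OF A_linear K(1)]
        compact_linear_image_of_linear[OF A_linear polytope_imp_compact[OF P(1)]] by auto
    have cvx: "convex (A t ` K)" "convex (A t ` P)"
      using convex_linear_image[OF A_linear K(2)]
        convex_linear_image[OF A_linear polytope_imp_convex[OF P(1)]] by auto
    have int: "interior (A t ` K) \<noteq> {}" "interior (A t ` P) \<noteq> {}"
      using K(3) intP by (auto simp: interior_A[OF t])
    have "area (frontier (A t ` K)) \<le> area (frontier (A t ` P))"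
      using cpt cvx int P(2) by (intro area_frontier_mono) (auto intro: compact_imp_bounded)
    then show "area (frontier (A t ` K)) \<le> ennreal (\<phi> t)"
      by (simp only: \<phi>(3)[OF t])
    define rK where "rK = (\<lambda>x. 0 + r *\<^sub>R x) ` (A t ` K)"
    have rK: "rK = A t ` ((*\<^sub>R) r ` K)"
      by (simp add: rK_def image_image linear_scale[OF A_linear])
    have "bounded rK"
      unfolding rK using K(1) by (intro bounded_linear_image_of_linear A_linear bounded_scaling compact_imp_bounded)
    moreover have "A t ` P \<subseteq> rK"
      unfolding rK using P(3) interior_subset by blast
    ultimately have "area (frontier (A t ` P)) \<le> area (frontier rK)"
      using cpt cvx int by (intro area_frontier_mono) auto
    also have "frontier rK = (\<lambda>x. 0 + r *\<^sub>R x) ` frontier (A t ` K)"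
      unfolding rK_def using assms frontier_linear_image[of "(*\<^sub>R) r" "A t ` K"]
      by (simp add: injective_scaleR)
    also have "area \<dots> \<le> ennreal (r ^ (DIM('a) - 1)) * area (frontier (A t ` K))"
      using assms by (intro hausdorff_measure_affinity_le) simp
    finally show "ennreal (\<phi> t) \<le> ennreal (r ^ (DIM('a) - 1)) * area (frontier (A t ` K))"
      by (simp only: \<phi>(3)[OF t])
  qed
qed

definition S :: "real \<Rightarrow> real" where
  "S t = surf (A t ` K)"

lemma S_eq:
  assumes "t > 0"
  shows "area (frontier (A t ` K)) = ennreal (S t)"
proof -
  obtain \<phi> where "area (frontier (A t ` K)) \<le> ennreal (\<phi> t)"
    using sandwich[of 2] assms by (metis one_less_numeral_iff semiring_norm(76))
  then have "area (frontier (A t ` K)) < top"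
    using ennreal_less_top le_less_trans by blast
  then show ?thesis
    by (simp add: S_def surf_def)
qed

lemma S_nonneg: "S t \<ge> 0"
  by (simp add: S_def surf_def)

lemma S_convex: "convex_on {0<..} S"
proof (rule convex_onI)
  fix u x y :: real
  assume u: "0 < u" "u < 1" and xy: "x \<in> {0<..}" "y \<in> {0<..}"
  define z where "z = (1 - u) * x + u * y"
  have pos: "x > 0" "y > 0" "z > 0"
    using u xy by (auto simp: z_def add_pos_pos)
  let ?d = "DIM('a) - 1"
  have "ennreal (S z) \<le> ennreal ((1 - u) * S x + u * S y)"
  proof (rule ennreal_le_of_le_powers)
    fix r :: real
    assume "r > 1"
    obtain \<phi> :: "real \<Rightarrow> real" where \<phi>: "convex_on UNIV \<phi>" "\<And>t. \<phi> t \<ge> 0"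
      "\<And>t. t > 0 \<Longrightarrow> ennreal (S t) \<le> ennreal (\<phi> t)"
      "\<And>t. t > 0 \<Longrightarrow> ennreal (\<phi> t) \<le> ennreal (r ^ ?d) * ennreal (S t)"
      using sandwich[OF \<open>r > 1\<close>] by (metis S_eq)
    have le: "S t \<le> \<phi> t" "\<phi> t \<le> r ^ ?d * S t" if "t > 0" for t
      using \<phi>(2)[of t] \<phi>(3,4)[OF that] S_nonneg \<open>r > 1\<close> by (simp_all add: ennreal_mult[symmetric])
    have "S z \<le> \<phi> z"
      using le pos by blast
    also have "\<dots> \<le> (1 - u) * \<phi> x + u * \<phi> y"
      using convex_onD[OF \<phi>(1), of u x y] u by (simp add: z_def)
    also have "\<dots> \<le> (1 - u) * (r ^ ?d * S x) + u * (r ^ ?d * S y)"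
      using le(2)[OF pos(1)] le(2)[OF pos(2)] u by (intro add_mono mult_left_mono) auto
    also have "\<dots> = r ^ ?d * ((1 - u) * S x + u * S y)"
      by (simp only: distrib_left mult_ac)
    finally show "ennreal (S z) \<le> ennreal (r ^ ?d) * ennreal ((1 - u) * S x + u * S y)"
      using \<open>r > 1\<close> u S_nonneg by (subst ennreal_mult[symmetric]) (auto intro!: ennreal_leI add_nonneg_nonneg)
  qed
  then show "S ((1 - u) *\<^sub>R x + u *\<^sub>R y) \<le> (1 - u) * S x + u * S y"
    using u S_nonneg by (simp add: z_def ennreal_plus[symmetric] del: ennreal_plus)
qed simp

text \<open>A small disc in \<open>K\<close> with normal vector \<open>u\<close> is stretched into a flat section of the stretched body,
  and the boundary has at least the area of such a section.\<close>

lemma S_lower_bound: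
  fixes u :: 'a
  assumes u: "norm u = 1"
  obtains m where "m > 0" "\<And>t. t > 0 \<Longrightarrow> m * norm (t *\<^sub>R u + ((1 - t) * (u \<bullet> v)) *\<^sub>R v) \<le> S t"
proof -
  obtain \<kappa> where \<kappa>: "\<kappa> > 0" "\<And>u \<alpha> F v t. norm u = 1 \<Longrightarrow> compact F \<Longrightarrow> F \<subseteq> {x::'a. x \<bullet> u = \<alpha>}
      \<Longrightarrow> norm v = 1 \<Longrightarrow> t > 0 \<Longrightarrow> area (orthogonal_affinity 0 v t ` F)
            = ennreal (\<kappa> * measure lebesgue (prism u F) * norm (t *\<^sub>R u + ((1 - t) * (u \<bullet> v)) *\<^sub>R v))"
    using area_of_stretched_flat_set by blast
  obtain \<rho> where \<rho>: "\<rho> > 0" "cball 0 \<rho> \<subseteq> K"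
    using K(3) by (meson mem_interior_cball)
  define F where "F = cball 0 \<rho> \<inter> {x. x \<bullet> u = 0}"
  have F: "compact F" "F \<subseteq> {x. x \<bullet> u = 0}" "F \<subseteq> K"
    using \<rho>(2) by (auto simp: F_def inner_commute[of _ u] intro!: compact_Int_closed closed_hyperplane)
  have uu: "u \<bullet> u = 1"
    using u by (simp add: norm_eq_1)
  have "ball ((1/2) *\<^sub>R u) (min \<rho> (1/2)) \<subseteq> prism u F"
  proof
    fix y assume y: "y \<in> ball ((1/2) *\<^sub>R u) (min \<rho> (1/2))"
    define d where "d = y - (1/2) *\<^sub>R u"
    have d: "norm d < \<rho>" "norm d < 1/2"
      using y by (auto simp: d_def dist_norm norm_minus_commute)
    have "\<bar>d \<bullet> u\<bar> \<le> norm d"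
      using Cauchy_Schwarz_ineq2[of d u] u by simp
    then have s: "1/2 + d \<bullet> u \<in> {0..1}"
      using d(2) by (auto simp: abs_le_iff)
    define x where "x = d - (d \<bullet> u) *\<^sub>R u"
    have xu: "x \<bullet> u = 0"
      using uu by (simp add: x_def inner_diff_left)
    then have "norm x \<le> norm (x + (d \<bullet> u) *\<^sub>R u)"
      by (intro norm_le_norm_add_of_inner_nonneg) simp
    then have "x \<in> F"
      using d(1) xu by (simp add: F_def x_def)
    moreover have "y = x + (1/2 + d \<bullet> u) *\<^sub>R u"
      by (simp add: x_def d_def algebra_simps)
    ultimately show "y \<in> prism u F"
      unfolding prism_def using s by blast
  qed
  then have le: "measure lebesgue (ball ((1/2) *\<^sub>R u) (min \<rho> (1/2))) \<le> measure lebesgue (prism u F)"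
    using compact_prism[OF F(1), of u] by (intro measure_mono_fmeasurable) (auto simp: lmeasurable_compact)
  have "0 < min \<rho> (1/2)"
    using \<rho>(1) by simp
  from less_le_trans[OF measure_lebesgue_ball_pos[OF this] le] have "0 < measure lebesgue (prism u F)" .
  then have m: "\<kappa> * measure lebesgue (prism u F) > 0"
    using \<kappa>(1) by simp
  show ?thesis
  proof (rule that[OF m])
    fix t :: real assume t: "t > 0"
    define n where "n = t *\<^sub>R u + ((1 - t) * (u \<bullet> v)) *\<^sub>R v"
    have n: "norm (n /\<^sub>R norm n) = 1"
      using measure_prism_orthogonal_affinity(1)[OF v u t F(1,2)] by (simp add: n_def)
    have "area (A t ` F) \<le> area (frontier (A t ` K))"
    proof (rule area_section_le_area_frontier[OF n])
      show "A t ` F \<subseteq> {x. x \<bullet> (n /\<^sub>R norm n) = t * 0 / norm n}"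
        unfolding n_def by (rule measure_prism_orthogonal_affinity(2)[OF v u t F(1,2)])
      show "A t ` F \<subseteq> A t ` K"
        using F(3) by blast
      show "bounded (A t ` K)"
        using K(1) by (intro bounded_linear_image_of_linear A_linear compact_imp_bounded)
    qed
    then have "ennreal (\<kappa> * measure lebesgue (prism u F) * norm n) \<le> ennreal (S t)"
      using \<kappa>(2)[OF u F(1,2) v t] by (simp only: S_eq[OF t] n_def)
    then show "\<kappa> * measure lebesgue (prism u F) * norm (t *\<^sub>R u + ((1 - t) * (u \<bullet> v)) *\<^sub>R v) \<le> S t"
      using S_nonneg by (simp add: n_def)
  qed
qed

text \<open>The disc with normal vector \<open>v\<close> is fixed by the stretching.\<close>

lemma S_ge_constant: "\<exists>a>0. \<forall>t>0. a \<le> S t"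
proof -
  obtain m where m: "m > 0" "\<And>t. t > 0 \<Longrightarrow> m * norm (t *\<^sub>R v + ((1 - t) * (v \<bullet> v)) *\<^sub>R v) \<le> S t"
    using S_lower_bound[OF v] by metis
  have "t *\<^sub>R v + ((1 - t) * (v \<bullet> v)) *\<^sub>R v = v" for t
    using v by (simp add: norm_eq_1 algebra_simps)
  then show ?thesis
    using m v by (metis mult.right_neutral)
qed

text \<open>A disc with normal vector orthogonal to \<open>v\<close> is itself stretched by the factor \<open>t\<close>.\<close>

lemma S_ge_linear:
  assumes "DIM('a) \<ge> 2"
  shows "\<exists>b>0. \<forall>t>0. b * t \<le> S t"
proof -
  obtain w where w: "w \<noteq> 0" "orthogonal v w"
    using orthogonal_to_vector_exists[OF assms] by metis
  define u where "u = w /\<^sub>R norm w"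
  have u: "norm u = 1" "u \<bullet> v = 0"
    using w by (simp_all add: u_def orthogonal_def inner_commute)
  obtain m where m: "m > 0" "\<And>t. t > 0 \<Longrightarrow> m * norm (t *\<^sub>R u + ((1 - t) * (u \<bullet> v)) *\<^sub>R v) \<le> S t"
    using S_lower_bound[OF u(1)] by metis
  then show ?thesis
    using u by (intro exI[of _ m]) (auto simp: abs_of_pos)
qed

end

text \<open>The center of mass affects the stretched body only by a translation, so it can be traded for an
  arbitrary point \<open>p\<close>.\<close>

lemma stretched_body_eq_translate:
  "stretched_body K v t = (+) (orthogonal_affinity 0 v t p - ((t - 1) * (v \<bullet> center_of_mass K)) *\<^sub>R v)
     ` (orthogonal_affinity 0 v t ` ((+) (- p) ` K))"
  unfolding stretched_body_def image_image
  by (rule image_cong)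
     (simp_all add: orthogonal_affinity_def inner_diff_right inner_add_right algebra_simps)

lemma surf_translation: "surf ((+) a ` K) = surf (K :: 'a::euclidean_space set)"
  by (simp add: surf_def frontier_translation hausdorff_measure_translation)

lemma stretching_translate:
  assumes "convex_body K" "norm v = 1" "p \<in> interior K"
  shows "stretching ((+) (- p) ` K) v"
proof
  have K: "compact K" "convex K"
    using assms(1) by (auto simp: convex_body_def)
  show "compact ((+) (- p) ` K)" "convex ((+) (- p) ` K)"
    using K by (simp_all only: compact_translation convex_translation)
  show "0 \<in> interior ((+) (- p) ` K)"
    unfolding interior_translation using assms(3) by (rule rev_image_eqI) simp
qed (rule assms(2))

lemma surf_stretched_body:
  fixes K :: "'a::euclidean_space set"
  assumes "convex_body K" "norm v = 1" "DIM('a) \<ge> 2"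
  obtains a b where "a > 0" "b > 0"
    "\<And>t. t > 0 \<Longrightarrow> a \<le> surf (stretched_body K v t)" "\<And>t. t > 0 \<Longrightarrow> b * t \<le> surf (stretched_body K v t)"
    "convex_on {0<..} (\<lambda>t. surf (stretched_body K v t))"
proof -
  obtain p where "p \<in> interior K"
    using assms(1) by (auto simp: convex_body_def)
  then interpret stretching "(+) (- p) ` K" v
    by (rule stretching_translate[OF assms(1,2)])
  have eq: "surf (stretched_body K v t) = S t" for t
    unfolding stretched_body_eq_translate[of K v t p] surf_translation S_def ..
  show ?thesis
    using that S_ge_constant S_ge_linear[OF assms(3)] S_convex unfolding eq by metis
qed

lemma surf_convex_body_pos:
  fixes K :: "'a::euclidean_space set"
  assumes "convex_body K" "DIM('a) \<ge> 2"
  shows "surf K > 0"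
proof -
  obtain v :: 'a where "v \<in> Basis"
    using nonempty_Basis by blast
  then have v: "norm v = 1"
    by simp
  obtain a where "a > 0" "a \<le> surf (stretched_body K v 1)"
    using surf_stretched_body[OF assms(1) v assms(2)] zero_less_one by metis
  moreover have "stretched_body K v 1 = K"
    by (simp add: stretched_body_def orthogonal_affinity_def)
  ultimately show ?thesis by simp
qed

lemma vol_convex_body_pos:
  fixes K :: "'a::euclidean_space set"
  assumes "convex_body K"
  shows "vol K > 0"
proof -
  obtain x e where e: "e > 0" "ball x e \<subseteq> K"
    using assms by (auto simp: convex_body_def mem_interior)
  have "measure lebesgue (ball x e) \<le> measure lebesgue K"
    using e(2) assms by (intro measure_mono_fmeasurable) (auto simp: convex_body_def lmeasurable_compact)
  then show ?thesis
    unfolding vol_def by (rule less_le_trans[OF measure_lebesgue_ball_pos[OF e(1), of x]])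
qed

lemma vol_stretched_body:
  fixes K :: "'a::euclidean_space set"
  assumes "convex_body K" "norm v = 1" "t > 0"
  shows "vol (stretched_body K v t) = t * vol K"
proof -
  have "K \<in> sets borel" "bounded K"
    using assms(1) by (auto simp: convex_body_def compact_imp_bounded borel_compact)
  then have "measure lebesgue (orthogonal_affinity 0 v t ` K) = t * measure lebesgue K"
    by (intro scales_volume_measure scales_volume_orthogonal_affinity assms)
  then show ?thesis
    unfolding stretched_body_eq_translate[of K v t 0] vol_def by (simp add: measure_translation)
qed

section \<open>The maximum of a power over a convex function\<close>

text \<open>The weighted inequality of arithmetic and geometric means for \<open>u\<close> and 1, in logarithmic form.\<close>

lemma powr_less_tangent:
  fixes u q :: real
  assumes "u > 0" "u \<noteq> 1" "0 < q" "q < 1"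
  shows "u powr q < 1 + q * (u - 1)"
proof -
  define A where "A = 1 + q * (u - 1)"
  have "A = (1 - q) + q * u"
    by (simp add: A_def algebra_simps)
  then have "A > 0"
    using assms by (simp add: add_pos_pos)
  have "A \<noteq> u"
  proof
    assume "A = u"
    then have "(1 - q) * (u - 1) = 0"
      by (simp add: A_def algebra_simps)
    then show False
      using assms by simp
  qed
  then have "u / A \<noteq> 1"
    using \<open>A > 0\<close> by simp
  then have "ln (u / A) < u / A - 1"
    using ln_le_minus_one[of "u / A"] ln_eq_minus_one[of "u / A"] \<open>A > 0\<close> \<open>u > 0\<close> by force
  moreover have "ln (1 / A) \<le> 1 / A - 1"
    using ln_le_minus_one[of "1 / A"] \<open>A > 0\<close> by simp
  ultimately have "q * ln (u / A) + (1 - q) * ln (1 / A) < q * (u / A - 1) + (1 - q) * (1 / A - 1)"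
    using assms by (intro add_less_le_mono mult_strict_left_mono mult_left_mono) auto
  also have "\<dots> = (q * u + (1 - q)) / A - 1"
    by (simp add: algebra_simps add_divide_distrib diff_divide_distrib)
  also have "\<dots> = 0"
    using \<open>A = (1 - q) + q * u\<close> \<open>A > 0\<close> by (simp add: add.commute)
  finally have "q * ln u < ln A"
    using \<open>A > 0\<close> \<open>u > 0\<close> by (simp add: ln_div algebra_simps)
  then have "exp (q * ln u) < exp (ln A)"
    by simp
  then show ?thesis
    using \<open>A > 0\<close> \<open>u > 0\<close> by (simp add: powr_def A_def[symmetric])
qed

text \<open>The tangent to the graph at \<open>z\<close> lies above the graph at \<open>x\<close> and \<open>y\<close>.\<close>

lemma powr_strictly_concave:
  fixes x y q \<tau> :: real
  assumes "x > 0" "y > 0" "x \<noteq> y" "0 < q" "q < 1" "0 < \<tau>" "\<tau> < 1"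
  shows "(1 - \<tau>) * x powr q + \<tau> * y powr q < ((1 - \<tau>) * x + \<tau> * y) powr q"
proof -
  define z where "z = (1 - \<tau>) * x + \<tau> * y"
  have "z > 0"
    using assms by (simp add: z_def add_pos_pos)
  have "z - x = \<tau> * (y - x)" "z - y = (1 - \<tau>) * (x - y)"
    by (simp_all add: z_def algebra_simps)
  then have "z \<noteq> x" "z \<noteq> y"
    using assms by auto
  have tangent: "w powr q < z powr q * (1 + q * (w / z - 1))" if "w > 0" "w \<noteq> z" for w
  proof -
    have "w powr q = z powr q * (w / z) powr q"
      using that \<open>z > 0\<close> by (simp add: powr_divide)
    also have "\<dots> < z powr q * (1 + q * (w / z - 1))"
      using powr_less_tangent[of "w / z" q] that \<open>z > 0\<close> assms by (intro mult_strict_left_mono) auto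
    finally show ?thesis .
  qed
  have "(1 - \<tau>) * x powr q + \<tau> * y powr q
      < (1 - \<tau>) * (z powr q * (1 + q * (x / z - 1))) + \<tau> * (z powr q * (1 + q * (y / z - 1)))"
    using tangent[of x] tangent[of y] assms \<open>z \<noteq> x\<close> \<open>z \<noteq> y\<close>
    by (intro add_strict_mono mult_strict_left_mono) auto
  also have "\<dots> = z powr q * (1 + q * (((1 - \<tau>) * x + \<tau> * y) / z - 1))"
    by (simp add: algebra_simps add_divide_distrib diff_divide_distrib)
  also have "\<dots> = z powr q"
    using \<open>z > 0\<close> by (simp add: z_def[symmetric])
  finally show ?thesis
    by (simp add: z_def)
qed

lemma convex_on_two_points:
  fixes S :: "real \<Rightarrow> real"
  assumes "convex_on {0<..} S" "x > 0" "y > 0" "0 \<le> \<tau>" "\<tau> \<le> 1"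
  shows "S ((1 - \<tau>) * x + \<tau> * y) \<le> (1 - \<tau>) * S x + \<tau> * S y"
  using convex_onD[OF assms(1), of \<tau> x y] assms by simp

text \<open>For \<open>c = S x / x powr q\<close> the function \<open>S t - c * t powr q\<close> is strictly convex and vanishes at \<open>x\<close>,
  and it is nonnegative exactly where the quotient is at most its value at \<open>x\<close>. At a local maximum
  \<open>x\<close> it is nonnegative near \<open>x\<close>, hence positive everywhere else, so that two local maxima would each
  be strictly higher than the other. At a local minimum it would be nonpositive near \<open>x\<close>, against
  strict convexity. The two lower bounds on \<open>S\<close> force the quotient to 0 at both ends of the half-line,
  so that it attains its supremum.\<close>

lemma quasiconcave_power_over_convex:
  fixes S :: "real \<Rightarrow> real"
  assumes conv: "convex_on {0<..} S" and q: "0 < q" "q < 1"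
    and a: "a > 0" "\<And>t. t > 0 \<Longrightarrow> a \<le> S t" and b: "b > 0" "\<And>t. t > 0 \<Longrightarrow> b * t \<le> S t"
  shows "quasiconcave_on {0<..} (\<lambda>t. t powr q / S t)"
proof -
  define h where "h t = t powr q / S t" for t
  have S_pos: "S t > 0" if "t > 0" for t
    using a(1) a(2)[OF that] by linarith
  have h_le: "h z \<le> h x \<longleftrightarrow> S x * z powr q \<le> S z * x powr q" if "x > 0" "z > 0" for x z
    using S_pos[OF that(1)] S_pos[OF that(2)] by (simp add: h_def field_simps)
  have h_less: "h z < h x \<longleftrightarrow> S x * z powr q < S z * x powr q" if "x > 0" "z > 0" for x z
    using S_pos[OF that(1)] S_pos[OF that(2)] by (simp add: h_def field_simps)
  have local_max_strict: "h y < h x" if max: "local_max_on {0<..} h x" and y: "y > 0" "y \<noteq> x" for x y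
  proof -
    have "x > 0"
      using max by (simp add: local_max_on_def)
    obtain e where e: "e > 0" "\<And>z. z > 0 \<Longrightarrow> z \<noteq> x \<Longrightarrow> dist z x < e \<Longrightarrow> h z \<le> h x"
      using max by (auto simp: local_max_on_def eventually_at)
    \<comment> \<open>small enough for the convex combination \<open>z\<close> to lie in the neighbourhood\<close>
    define \<tau> where "\<tau> = min (1/2) (e / (2 * \<bar>y - x\<bar>))"
    have \<tau>: "0 < \<tau>" "\<tau> < 1"
      using e(1) y(2) by (auto simp: \<tau>_def)
    define z where "z = (1 - \<tau>) * x + \<tau> * y"
    have "z > 0"
      using \<tau> \<open>x > 0\<close> \<open>y > 0\<close> by (simp add: z_def add_pos_pos)
    have z_x: "z - x = \<tau> * (y - x)"
      by (simp add: z_def algebra_simps)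
    have "\<tau> * \<bar>y - x\<bar> \<le> e / (2 * \<bar>y - x\<bar>) * \<bar>y - x\<bar>"
      by (intro mult_right_mono) (auto simp: \<tau>_def)
    also have "\<dots> < e"
      using e(1) y(2) by simp
    finally have "dist z x < e"
      using \<tau> by (simp add: dist_real_def z_x abs_mult)
    moreover have "z \<noteq> x"
      using z_x \<tau> y(2) by auto
    ultimately have "h z \<le> h x"
      using e(2) \<open>z > 0\<close> by blast
    then have "S x * z powr q \<le> S z * x powr q"
      using h_le \<open>x > 0\<close> \<open>z > 0\<close> by blast
    moreover have "S x * ((1 - \<tau>) * x powr q + \<tau> * y powr q) < S x * z powr q"
      unfolding z_def using S_pos[OF \<open>x > 0\<close>] \<open>x > 0\<close> y q \<tau>
      by (intro mult_strict_left_mono powr_strictly_concave) auto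
    moreover have "S z * x powr q \<le> ((1 - \<tau>) * S x + \<tau> * S y) * x powr q"
      unfolding z_def using \<tau> \<open>x > 0\<close> \<open>y > 0\<close>
      by (intro mult_right_mono convex_on_two_points[OF conv]) auto
    ultimately have "S x * ((1 - \<tau>) * x powr q + \<tau> * y powr q) < ((1 - \<tau>) * S x + \<tau> * S y) * x powr q"
      by linarith
    then have "\<tau> * (S x * y powr q) < \<tau> * (S y * x powr q)"
      by (simp add: algebra_simps)
    then show ?thesis
      using h_less \<open>x > 0\<close> \<open>y > 0\<close> \<tau> by simp
  qed
  have no_min: "\<not> local_min_on {0<..} h x" for x
  proof
    assume min: "local_min_on {0<..} h x"
    then have "x > 0"
      by (simp add: local_min_on_def)
    obtain e where e: "e > 0" "\<And>z. z > 0 \<Longrightarrow> z \<noteq> x \<Longrightarrow> dist z x < e \<Longrightarrow> h x \<le> h z"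
      using min by (auto simp: local_min_on_def eventually_at)
    define \<delta> where "\<delta> = min x e / 2"
    have \<delta>: "0 < \<delta>" "\<delta> < x" "\<delta> < e"
      using \<open>x > 0\<close> e(1) by (auto simp: \<delta>_def min_def)
    have "h x \<le> h (x - \<delta>)" "h x \<le> h (x + \<delta>)"
      using \<delta> \<open>x > 0\<close> by (auto intro!: e(2) simp: dist_real_def)
    then have "S (x - \<delta>) * x powr q \<le> S x * (x - \<delta>) powr q" "S (x + \<delta>) * x powr q \<le> S x * (x + \<delta>) powr q"
      using h_le[of "x - \<delta>" x] h_le[of "x + \<delta>" x] \<delta> \<open>x > 0\<close> by auto
    then have "(S (x - \<delta>) + S (x + \<delta>)) * x powr q \<le> S x * ((x - \<delta>) powr q + (x + \<delta>) powr q)"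
      by (simp add: algebra_simps)
    moreover have "S x * ((x - \<delta>) powr q + (x + \<delta>) powr q) < S x * (2 * x powr q)"
    proof -
      have "(1 - \<delta> / (2 * \<delta>)) * (x - \<delta>) + \<delta> / (2 * \<delta>) * (x + \<delta>) = x"
        using \<delta> by (simp add: field_simps)
      then have "(x - \<delta>) powr q + (x + \<delta>) powr q < 2 * x powr q"
        using powr_strictly_concave[of "x - \<delta>" "x + \<delta>" q "1/2"] \<delta> q \<open>x > 0\<close> by simp
      then show ?thesis
        using S_pos[OF \<open>x > 0\<close>] by (intro mult_strict_left_mono)
    qed
    moreover have "S x * (2 * x powr q) \<le> (S (x - \<delta>) + S (x + \<delta>)) * x powr q"
    proof -
      have "(1 - 1/2) * (x - \<delta>) + 1/2 * (x + \<delta>) = x"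
        by (simp add: field_simps)
      then have "2 * S x \<le> S (x - \<delta>) + S (x + \<delta>)"
        using convex_on_two_points[OF conv, of "x - \<delta>" "x + \<delta>" "1/2"] \<delta> \<open>x > 0\<close> by simp
      then have "(2 * S x) * x powr q \<le> (S (x - \<delta>) + S (x + \<delta>)) * x powr q"
        by (rule mult_right_mono) simp
      then show ?thesis
        by (simp add: mult_ac)
    qed
    ultimately show False by linarith
  qed
  have ex_max: "\<exists>x. local_max_on {0<..} h x"
  proof -
    have h1: "h 1 > 0"
      using S_pos[of 1] by (simp add: h_def)
    \<comment> \<open>left of \<open>l\<close> and right of \<open>M\<close> the bounds \<open>a \<le> S t\<close> and \<open>b * t \<le> S t\<close> keep the quotient at or below its value at 1\<close>
    define l where "l = min 1 ((a * h 1) powr (1/q))"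
    define M where "M = max 1 ((b * h 1) powr (1/(q - 1)))"
    have l: "0 < l" "l \<le> 1" and M: "1 \<le> M"
      using h1 a(1) by (auto simp: l_def M_def)
    have small: "h t \<le> h 1" if "0 < t" "t \<le> l" for t
    proof -
      have "t powr q \<le> ((a * h 1) powr (1/q)) powr q"
        using that q by (intro powr_mono2) (auto simp: l_def)
      also have "\<dots> = a * h 1"
        using q h1 a(1) by (simp add: powr_powr)
      also have "\<dots> \<le> S t * h 1"
        using a(2)[OF that(1)] h1 by (intro mult_right_mono) auto
      finally show ?thesis
        using S_pos[OF that(1)] by (simp add: h_def[of t] divide_le_eq mult.commute)
    qed
    have large: "h t \<le> h 1" if "M \<le> t" for t
    proof -
      have "t > 0"
        using M that by simp
      have bh: "b * h 1 > 0"
        using b(1) h1 by simp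
      have "t powr (q - 1) \<le> ((b * h 1) powr (1/(q - 1))) powr (q - 1)"
        using that q bh by (intro powr_mono2') (auto simp: M_def)
      also have "\<dots> = b * h 1"
        using q bh by (simp add: powr_powr)
      finally have "t powr (q - 1) * t \<le> b * h 1 * t"
        using \<open>t > 0\<close> by (intro mult_right_mono) auto
      also have "t powr (q - 1) * t = t powr q"
        using \<open>t > 0\<close> by (simp add: powr_diff)
      also have "b * h 1 * t \<le> S t * h 1"
        using mult_right_mono[OF b(2)[OF \<open>t > 0\<close>], of "h 1"] h1 by (simp add: mult_ac)
      finally show ?thesis
        using S_pos[OF \<open>t > 0\<close>] by (simp add: h_def[of t] divide_le_eq mult.commute)
    qed
    have "continuous_on {0<..} S"
      using conv by (intro convex_on_continuous) auto
    then have "continuous_on {l..M} S"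
      by (rule continuous_on_subset) (use l in auto)
    moreover have "S t \<noteq> 0" if "t \<in> {l..M}" for t
      using S_pos[of t] l that by force
    ultimately have "continuous_on {l..M} h"
      unfolding h_def[abs_def] using l by (intro continuous_intros) auto
    moreover have "compact {l..M}" "{l..M} \<noteq> {}"
      using l M by auto
    ultimately obtain x where x: "x \<in> {l..M}" "\<And>t. t \<in> {l..M} \<Longrightarrow> h t \<le> h x"
      using continuous_attains_sup by metis
    have "h 1 \<le> h x"
      using l M by (intro x(2)) auto
    have "h t \<le> h x" if "t > 0" for t
    proof (cases "t \<in> {l..M}")
      case False
      then have "h t \<le> h 1"
        using small[of t] large[of t] that by force
      with \<open>h 1 \<le> h x\<close> show ?thesis by linarith
    qed (rule x(2))
    then have "local_max_on {0<..} h x"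
      using x(1) l(1) by (auto simp: local_max_on_def eventually_at intro!: exI[of _ 1])
    then show ?thesis by blast
  qed
  have "\<exists>!x. local_max_on {0<..} h x"
  proof (rule ex_ex1I[OF ex_max])
    fix x y assume xy: "local_max_on {0<..} h x" "local_max_on {0<..} h y"
    show "x = y"
    proof (rule ccontr)
      assume "x \<noteq> y"
      then have "h y < h x" "h x < h y"
        using xy local_max_strict by (auto simp: local_max_on_def)
      then show False by simp
    qed
  qed
  with no_min show ?thesis
    by (simp add: quasiconcave_on_def h_def[abs_def])
qed

text \<open>Local extrema depend only on the order of the values, so positive factors and positive powers can be
  discarded.\<close>

lemma quasiconcave_on_cong_order:
  assumes "\<And>x y. x \<in> T \<Longrightarrow> y \<in> T \<Longrightarrow> f x \<le> f y \<longleftrightarrow> g x \<le> g y" "quasiconcave_on T f"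
  shows "quasiconcave_on T g"
proof -
  have "local_max_on T f x \<longleftrightarrow> local_max_on T g x" "local_min_on T f x \<longleftrightarrow> local_min_on T g x" for x
    using assms(1) by (auto simp: local_max_on_def local_min_on_def eventually_at_filter elim!: eventually_mono)
  then show ?thesis
    using assms(2) by (simp add: quasiconcave_on_def)
qed

section \<open>The isoperimetric ratio\<close>

theorem theorem6:
  fixes K :: "'a::euclidean_space set" and v :: 'a
  assumes "DIM('a) \<ge> 2"
    and "convex_body K"
    and "v \<in> sphere 0 1"
  shows "quasiconcave_on {0<..} (\<lambda>t. isoperimetric_ratio (stretched_body K v t))"
proof -
  define n where "n = real DIM('a)"
  define p where "p = n / (n - 1)"
  define q where "q = (n - 1) / n"
  have n: "n \<ge> 2"
    using assms(1) by (simp add: n_def)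
  have pq: "p > 0" "0 < q" "q < 1" "q * p = 1"
    using n by (auto simp: p_def q_def field_simps)
  define S where "S t = surf (stretched_body K v t)" for t
  have v: "norm v = 1"
    using assms(3) by simp
  obtain a b where ab: "a > 0" "b > 0" "\<And>t. t > 0 \<Longrightarrow> a \<le> S t" "\<And>t. t > 0 \<Longrightarrow> b * t \<le> S t"
    and conv: "convex_on {0<..} S"
    unfolding S_def using surf_stretched_body[OF assms(2) v assms(1)] by metis
  have volK: "vol K > 0"
    using assms(2) by (rule vol_convex_body_pos)
  define c where "c = vol K * (surf (cball 0 1 :: 'a set) powr p / vol (cball 0 1 :: 'a set))"
  have ball: "convex_body (cball 0 1 :: 'a set)"
    by (simp add: convex_body_def)
  have "c > 0"
    using volK vol_convex_body_pos[OF ball] surf_convex_body_pos[OF ball assms(1)] by (simp add: c_def)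
  have ratio: "isoperimetric_ratio (stretched_body K v t) = c * (t powr q / S t) powr p" if "t > 0" for t
  proof -
    have "S t > 0"
      using ab(1) ab(3)[OF that] by linarith
    then have "(t powr q / S t) powr p = t / S t powr p"
      using that pq by (simp add: powr_divide powr_powr)
    then show ?thesis
      using vol_stretched_body[OF assms(2) v that]
      by (simp add: isoperimetric_ratio_def Let_def c_def S_def p_def n_def mult_ac)
  qed
  have "quasiconcave_on {0<..} (\<lambda>t. t powr q / S t)"
    by (rule quasiconcave_power_over_convex[OF conv pq(2,3) ab(1,3,2,4)])
  then show ?thesis
  proof (rule quasiconcave_on_cong_order[rotated])
    fix x y :: real
    assume "x \<in> {0<..}" "y \<in> {0<..}"
    then have xy: "x > 0" "y > 0" by auto
    have "0 \<le> x powr q / S x" "0 \<le> y powr q / S y"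
      using ab(1) ab(3)[OF xy(1)] ab(3)[OF xy(2)] by auto
    then have "x powr q / S x \<le> y powr q / S y \<longleftrightarrow> (x powr q / S x) powr p \<le> (y powr q / S y) powr p"
      using powr_mono2[of p] powr_less_mono2[of p] pq(1) by (meson less_imp_le not_le)
    then show "x powr q / S x \<le> y powr q / S y \<longleftrightarrow>
        isoperimetric_ratio (stretched_body K v x) \<le> isoperimetric_ratio (stretched_body K v y)"
      using \<open>c > 0\<close> by (simp add: ratio xy)
  qed
qed

end
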